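(* There are $\omega$-bounded Type I spaces $X,T$ which are normal, connected and locally metrizable, and a club $D\subset X$ which is a $T$-direction but not an $\mathbb{L}_{\ge 0}$-direction in $X$.
   Context: All spaces are Hausdorff and all functions are continuous unless otherwise specified. A space $X$ is Type I if $X=\bigcup_{\alpha<\omega_1}X_\alpha$ with each $X_\alpha$ open, $\overline{X_\alpha}$ Lindelöf, and $\overline{X_\alpha}\subset X_\beta$ whenever $\alpha<\beta$; Type I spaces are always assumed non-Lindelöf. A subset of a Type I space is bounded if it is contained in some $X_\alpha$, otherwise unbounded; a function into a Type I space is (un)bounded if its range is. Club means closed and unbounded. $\mathbb{L}_{\ge 0}$ is the closed long ray $\omega_1\times[0,1)$ with the lexicographic order topology (with $X_\alpha=[0,\alpha)$). Let $X,Y$ be Type I spaces and $D\subset X$ be club. $D$ is a $Y$-direction in $X$ if for every continuous $f:X\to Y$ with $f$ unbounded on $D$, $f$ is unbounded on any club subset of $D$ as well. A space is $\omega$-bounded if the closure of every countable subset is compact. *)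

theory Defs
  imports "HOL-Analysis.Analysis" "HOL-Library.Countable_Set_Type"
begin

text \<open>The ordinal \<open>\<omega>\<^sub>1\<close>, as the least uncountable cardinal with its canonical well-order.\<close>

typedef omega1 = "Field (cardSuc natLeq)"
  morphisms Rep_omega1 Abs_omega1
proof -
  have "infinite (Field (cardSuc natLeq))"
    using cardSuc_finite[OF natLeq_Card_order] by (simp add: Field_natLeq)
  then have "Field (cardSuc natLeq) \<noteq> {}" by auto
  then show "\<exists>x. x \<in> Field (cardSuc natLeq)" by blast
qed

lemma Well_order_cardSuc_natLeq: "Well_order (cardSuc natLeq)"
  using cardSuc_Card_order[OF natLeq_Card_order] card_order_on_well_order_on by blast

instantiation omega1 :: wellorder
begin

definition less_eq_omega1 :: "omega1 \<Rightarrow> omega1 \<Rightarrow> bool" where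
  "\<alpha> \<le> \<beta> \<longleftrightarrow> (Rep_omega1 \<alpha>, Rep_omega1 \<beta>) \<in> cardSuc natLeq"

definition less_omega1 :: "omega1 \<Rightarrow> omega1 \<Rightarrow> bool" where
  "\<alpha> < \<beta> \<longleftrightarrow> \<alpha> \<le> \<beta> \<and> \<alpha> \<noteq> (\<beta> :: omega1)"

instance
proof
  note W = Well_order_cardSuc_natLeq[unfolded well_order_on_def linear_order_on_def
      partial_order_on_def preorder_on_def]
  fix x y z :: omega1
  have antisym: "x \<le> y \<Longrightarrow> y \<le> x \<Longrightarrow> x = y" for x y :: omega1
    using W unfolding antisym_def less_eq_omega1_def by (metis Rep_omega1_inject)
  show "x < y \<longleftrightarrow> x \<le> y \<and> \<not> y \<le> x"
    using antisym W Rep_omega1 unfolding less_omega1_def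
    by (metis less_eq_omega1_def refl_onD)
  show "x \<le> x"
    using W Rep_omega1 unfolding less_eq_omega1_def by (meson refl_onD)
  show "x \<le> y \<Longrightarrow> y \<le> z \<Longrightarrow> x \<le> z"
    using W unfolding less_eq_omega1_def by (meson transD)
  show "x \<le> y \<Longrightarrow> y \<le> x \<Longrightarrow> x = y"
    by (rule antisym)
  show "x \<le> y \<or> y \<le> x"
    using W Rep_omega1 unfolding less_eq_omega1_def total_on_def
    by (metis refl_onD)
next
  fix P :: "omega1 \<Rightarrow> bool" and a :: omega1
  assume step: "\<And>x. (\<And>y. y < x \<Longrightarrow> P y) \<Longrightarrow> P x"
  have "wf (inv_image (cardSuc natLeq - Id) Rep_omega1)"
    using Well_order_cardSuc_natLeq by (auto simp: well_order_on_def)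
  then show "P a"
  proof (induction a rule: wf_induct_rule)
    case (less x)
    show ?case
    proof (rule step)
      fix y assume "y < x"
      then show "P y"
        by (intro less) (auto simp: less_omega1_def less_eq_omega1_def Rep_omega1_inject)
    qed
  qed
qed

end

context includes cardinal_syntax
begin

lemma countable_lessThan_omega1: "countable {..<\<alpha> :: omega1}"
proof -
  let ?r = "cardSuc natLeq"
  have "|underS ?r (Rep_omega1 \<alpha>)| <o ?r"
    by (rule card_of_underS[OF cardSuc_Card_order[OF natLeq_Card_order] Rep_omega1])
  then have "|underS ?r (Rep_omega1 \<alpha>)| \<le>o natLeq"
    by (simp only: cardSuc_ordLeq_ordLess[OF natLeq_Card_order card_of_Card_order])
  then have c: "countable (underS ?r (Rep_omega1 \<alpha>))"
    by (simp add: countable_card_le_natLeq)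
  have "Rep_omega1 ` {..<\<alpha>} \<subseteq> underS ?r (Rep_omega1 \<alpha>)"
    by (auto simp: underS_def less_omega1_def less_eq_omega1_def Rep_omega1_inject)
  then have "countable (Rep_omega1 ` {..<\<alpha>})"
    using c countable_subset by blast
  then show ?thesis
    by (rule countable_image_inj_on) (simp add: inj_on_def Rep_omega1_inject)
qed

lemma uncountable_UNIV_omega1: "uncountable (UNIV :: omega1 set)"
proof
  let ?r = "cardSuc natLeq"
  assume "countable (UNIV :: omega1 set)"
  then have "countable (range Rep_omega1)" by blast
  also have "range Rep_omega1 = Field ?r"
    by (rule type_definition.Rep_range[OF type_definition_omega1])
  finally have 1: "|Field ?r| \<le>o natLeq"
    by (simp add: countable_card_le_natLeq)
  have "( |Field ?r|, ?r) \<in> ordIso"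
    by (rule card_of_Field_ordIso[OF cardSuc_Card_order[OF natLeq_Card_order]])
  then have "?r \<le>o natLeq"
    using 1 ordIso_ordLeq_trans ordIso_symmetric by blast
  then show False
    using cardSuc_greater[OF natLeq_Card_order] not_ordLess_ordLeq by blast
qed

end

lemma countable_bounded_omega1:
  assumes "countable (A :: omega1 set)"
  shows "\<exists>\<beta>. \<forall>\<alpha>\<in>A. \<alpha> < \<beta>"
proof (rule ccontr)
  assume "\<not> ?thesis"
  then have "UNIV = (\<Union>\<alpha>\<in>A. insert \<alpha> {..<\<alpha>})"
    by (force simp: not_less le_less)
  moreover have "countable (\<Union>\<alpha>\<in>A. insert \<alpha> {..<\<alpha>})"
    using assms countable_lessThan_omega1 by blast
  ultimately show False
    using uncountable_UNIV_omega1 by simp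
qed


text \<open>The closed long ray \<open>\<omega>\<^sub>1 \<times> [0,1)\<close>: lexicographic order and order topology.\<close>

typedef long_ray = "UNIV \<times> {0..<1} :: (omega1 \<times> real) set"
  morphisms Rep_long_ray Abs_long_ray
  by (intro exI[of _ "(undefined, 0)"]) simp

instantiation long_ray :: linorder
begin

definition less_eq_long_ray :: "long_ray \<Rightarrow> long_ray \<Rightarrow> bool" where
  "x \<le> y \<longleftrightarrow> fst (Rep_long_ray x) < fst (Rep_long_ray y) \<or>
     fst (Rep_long_ray x) = fst (Rep_long_ray y) \<and> snd (Rep_long_ray x) \<le> snd (Rep_long_ray y)"

definition less_long_ray :: "long_ray \<Rightarrow> long_ray \<Rightarrow> bool" where
  "x < y \<longleftrightarrow> fst (Rep_long_ray x) < fst (Rep_long_ray y) \<or>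
     fst (Rep_long_ray x) = fst (Rep_long_ray y) \<and> snd (Rep_long_ray x) < snd (Rep_long_ray y)"

instance
proof
  fix x y z :: long_ray
  show "x < y \<longleftrightarrow> x \<le> y \<and> \<not> y \<le> x"
    by (auto simp: less_eq_long_ray_def less_long_ray_def)
  show "x \<le> x" by (simp add: less_eq_long_ray_def)
  show "x \<le> y \<Longrightarrow> y \<le> z \<Longrightarrow> x \<le> z"
    by (auto simp: less_eq_long_ray_def)
  show "x \<le> y \<Longrightarrow> y \<le> x \<Longrightarrow> x = y"
    by (auto simp: less_eq_long_ray_def simp flip: Rep_long_ray_inject intro: prod_eqI)
  show "x \<le> y \<or> y \<le> x"
    by (auto simp: less_eq_long_ray_def)
qed

end

instantiation long_ray :: linorder_topology
begin

definition open_long_ray :: "long_ray set \<Rightarrow> bool" where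
  "open_long_ray = generate_topology (range (\<lambda>a. {..<a}) \<union> range (\<lambda>a. {a<..}))"

instance
  by standard (rule open_long_ray_def)

end


text \<open>Type I spaces include the standing assumptions: Hausdorff and not Lindelof.\<close>

definition type_I_cover :: "'a topology \<Rightarrow> (omega1 \<Rightarrow> 'a set) \<Rightarrow> bool" where
  "type_I_cover X U \<longleftrightarrow>
     topspace X = (\<Union>\<alpha>. U \<alpha>) \<and>
     (\<forall>\<alpha>. openin X (U \<alpha>)) \<and>
     (\<forall>\<alpha>. Lindelof_space (subtopology X (X closure_of U \<alpha>))) \<and>
     (\<forall>\<alpha> \<beta>. \<alpha> < \<beta> \<longrightarrow> X closure_of U \<alpha> \<subseteq> U \<beta>)"

definition type_I_space :: "'a topology \<Rightarrow> bool" where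
  "type_I_space X \<longleftrightarrow>
     Hausdorff_space X \<and> \<not> Lindelof_space X \<and> (\<exists>U. type_I_cover X U)"

text \<open>Boundedness does not depend on the choice of the family \<open>X\<^sub>\<alpha>\<close>; see
  \<open>bounded_in_iff\<close> below.\<close>

definition bounded_in :: "'a topology \<Rightarrow> 'a set \<Rightarrow> bool" where
  "bounded_in X S \<longleftrightarrow> (\<exists>U \<alpha>. type_I_cover X U \<and> S \<subseteq> U \<alpha>)"

lemma type_I_cover_mono:
  assumes "type_I_cover X U" "\<alpha> \<le> \<beta>"
  shows "U \<alpha> \<subseteq> U \<beta>"
proof (cases "\<alpha> = \<beta>")
  case False
  then have "X closure_of U \<alpha> \<subseteq> U \<beta>"
    using assms by (simp add: type_I_cover_def)
  moreover have "U \<alpha> \<subseteq> X closure_of U \<alpha>"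
    using assms(1) by (meson closure_of_subset openin_subset type_I_cover_def)
  ultimately show ?thesis by blast
qed simp

lemma Lindelof_subset_type_I_cover:
  assumes U: "type_I_cover X U" and K: "K \<subseteq> topspace X" "Lindelof_space (subtopology X K)"
  shows "\<exists>\<alpha>. K \<subseteq> U \<alpha>"
proof -
  have "(\<forall>V\<in>range U. openin X V) \<and> K \<subseteq> \<Union> (range U)"
    using U K(1) by (auto simp: type_I_cover_def)
  then obtain \<V> where \<V>: "countable \<V>" "\<V> \<subseteq> range U" "K \<subseteq> \<Union>\<V>"
    using K(2)[unfolded Lindelof_space_subtopology_subset[OF K(1)], rule_format, of "range U"]
    by blast
  then obtain A where A: "countable A" "\<V> = U ` A"
    by (metis countable_subset_image)
  obtain \<beta> where "\<forall>\<alpha>\<in>A. \<alpha> < \<beta>"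
    using countable_bounded_omega1[OF A(1)] by blast
  then have "U \<alpha> \<subseteq> U \<beta>" if "\<alpha> \<in> A" for \<alpha>
    using that by (intro type_I_cover_mono[OF U] less_imp_le) blast
  then have "\<Union>\<V> \<subseteq> U \<beta>"
    unfolding A(2) by blast
  then show ?thesis using \<V>(3) by blast
qed

lemma bounded_in_iff:
  assumes "type_I_cover X U"
  shows "bounded_in X S \<longleftrightarrow> (\<exists>\<alpha>. S \<subseteq> U \<alpha>)"
proof
  assume "bounded_in X S"
  then obtain V \<beta> where V: "type_I_cover X V" "S \<subseteq> V \<beta>"
    by (auto simp: bounded_in_def)
  have "\<exists>\<alpha>. X closure_of V \<beta> \<subseteq> U \<alpha>"
    using V(1) by (intro Lindelof_subset_type_I_cover[OF assms] closure_of_subset_topspace)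
      (auto simp: type_I_cover_def)
  moreover have "V \<beta> \<subseteq> X closure_of V \<beta>"
    using V(1) by (meson closure_of_subset openin_subset type_I_cover_def)
  ultimately show "\<exists>\<alpha>. S \<subseteq> U \<alpha>"
    using V(2) by blast
qed (use assms in \<open>auto simp: bounded_in_def\<close>)

definition club_in :: "'a topology \<Rightarrow> 'a set \<Rightarrow> bool" where
  "club_in X D \<longleftrightarrow> closedin X D \<and> \<not> bounded_in X D"

text \<open>Meant for Type I spaces \<open>X\<close>, \<open>Y\<close> and for \<open>D\<close> club in \<open>X\<close>; these are not part of
  the definition, so that its negation only speaks about maps. Since \<open>D\<close> is closed in \<open>X\<close>,
  a club subset of \<open>D\<close> is the same as a club set of \<open>X\<close> that lies in \<open>D\<close>.\<close>

definition direction_in :: "'a topology \<Rightarrow> 'b topology \<Rightarrow> 'a set \<Rightarrow> bool" where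
  "direction_in X Y D \<longleftrightarrow>
     (\<forall>f. continuous_map X Y f \<and> \<not> bounded_in Y (f ` D) \<longrightarrow>
        (\<forall>C. C \<subseteq> D \<and> club_in X C \<longrightarrow> \<not> bounded_in Y (f ` C)))"

definition omega_bounded_space :: "'a topology \<Rightarrow> bool" where
  "omega_bounded_space X \<longleftrightarrow>
     (\<forall>A. A \<subseteq> topspace X \<and> countable A \<longrightarrow> compactin X (X closure_of A))"

definition locally_metrizable_space :: "'a topology \<Rightarrow> bool" where
  "locally_metrizable_space X \<longleftrightarrow>
     (\<forall>x\<in>topspace X. \<exists>U. openin X U \<and> x \<in> U \<and> metrizable_space (subtopology X U))"


text \<open>The long ray is a Type I space, with \<open>X\<^sub>\<alpha> = [0, \<alpha>)\<close>.\<close>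

definition long_ray_ord :: "omega1 \<Rightarrow> long_ray" where
  "long_ray_ord \<alpha> = Abs_long_ray (\<alpha>, 0)"

lemma Rep_long_ray_Abs: "0 \<le> t \<Longrightarrow> t < 1 \<Longrightarrow> Rep_long_ray (Abs_long_ray (\<alpha>, t)) = (\<alpha>, t)"
  by (rule Abs_long_ray_inverse) simp

lemma less_long_ray_ord_iff: "x < long_ray_ord \<alpha> \<longleftrightarrow> fst (Rep_long_ray x) < \<alpha>"
  using Rep_long_ray[of x]
  by (auto simp: long_ray_ord_def less_long_ray_def Rep_long_ray_Abs mem_Times_iff)

lemma continuous_on_long_ray_segment:
  "continuous_on {0..<1} (\<lambda>t. Abs_long_ray (\<alpha>, t))"
proof -
  let ?f = "\<lambda>t. Abs_long_ray (\<alpha>, t)"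
  have *: "\<exists>T. open T \<and> T \<inter> {0..<1} = ?f -` B \<inter> {0..<1}"
    if B: "B \<in> range (\<lambda>a. {..<a}) \<union> range (\<lambda>a. {a<..})" for B
  proof -
    consider a where "B = {..<a}" | a where "B = {a<..}" using B by auto
    then show ?thesis
    proof cases
      case (1 a)
      show ?thesis
        by (rule exI[of _ "if \<alpha> < fst (Rep_long_ray a) then UNIV
              else if \<alpha> = fst (Rep_long_ray a) then {..<snd (Rep_long_ray a)} else {}"])
          (auto simp: 1 less_long_ray_def Rep_long_ray_Abs)
    next
      case (2 a)
      show ?thesis
        by (rule exI[of _ "if fst (Rep_long_ray a) < \<alpha> then UNIV
              else if \<alpha> = fst (Rep_long_ray a) then {snd (Rep_long_ray a)<..} else {}"])
          (auto simp: 2 less_long_ray_def Rep_long_ray_Abs)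
    qed
  qed
  have "\<exists>T. open T \<and> T \<inter> {0..<1} = ?f -` B \<inter> {0..<1}" if "open B" for B
  proof -
    have "generate_topology (range (\<lambda>a. {..<a}) \<union> range (\<lambda>a. {a<..})) B"
      using that by (simp add: open_long_ray_def)
    then show ?thesis
    proof induction
      case UNIV
      then show ?case by (intro exI[of _ UNIV]) simp
    next
      case (Int a b)
      then obtain S T where "open S" "S \<inter> {0..<1} = ?f -` a \<inter> {0..<1}"
        "open T" "T \<inter> {0..<1} = ?f -` b \<inter> {0..<1}" by blast
      then show ?case by (intro exI[of _ "S \<inter> T"]) auto
    next
      case (UN K)
      then obtain T where "\<forall>k\<in>K. open (T k) \<and> T k \<inter> {0..<1} = ?f -` k \<inter> {0..<1}"
        by metis
      then show ?case by (intro exI[of _ "\<Union>k\<in>K. T k"]) auto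
    next
      case (Basis s)
      then show ?case by (rule *)
    qed
  qed
  then show ?thesis unfolding continuous_on_open_invariant by blast
qed

lemma Lindelof_long_ray_Iic:
  "Lindelof_space (subtopology euclidean {..long_ray_ord \<alpha>})"
proof -
  let ?S = "\<lambda>\<beta>. (\<lambda>t. Abs_long_ray (\<beta>, t)) ` {0..<1}"
  have seg: "Lindelof_space (subtopology euclidean (?S \<beta>))" for \<beta>
  proof -
    have "Lindelof_space (top_of_set {0..<1::real})"
      unfolding Lindelof_space_def
    proof (intro allI impI, elim conjE)
      fix \<U> :: "real set set"
      assume "\<forall>U\<in>\<U>. openin (top_of_set {0..<1}) U" and U: "\<Union>\<U> = topspace (top_of_set {0..<1})"
      then obtain \<V> where "\<V> \<subseteq> \<U>" "countable \<V>" "\<Union>\<V> = \<Union>\<U>"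
        using Lindelof_openin[of \<U> "{0..<1}"] by metis
      then show "\<exists>\<V>. countable \<V> \<and> \<V> \<subseteq> \<U> \<and> \<Union>\<V> = topspace (top_of_set {0..<1})"
        using U by metis
    qed
    moreover have "continuous_map (top_of_set {0..<1}) (top_of_set (?S \<beta>)) (\<lambda>t. Abs_long_ray (\<beta>, t))"
      using continuous_on_long_ray_segment by (simp add: continuous_map_in_subtopology)
    ultimately show ?thesis
      by (rule Lindelof_space_continuous_map_image) simp
  qed
  have union: "Lindelof_space (subtopology euclidean (\<Union> (?S ` {..\<alpha>})))"
  proof (rule Lindelof_space_Union)
    have "{..\<alpha>} = insert \<alpha> {..<\<alpha>}" by (simp add: set_eq_iff le_less disj_commute)
    then show "countable (?S ` {..\<alpha>})"
      using countable_lessThan_omega1[of \<alpha>] by simp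
  qed (use seg in auto)
  have sub: "{..long_ray_ord \<alpha>} \<subseteq> \<Union> (?S ` {..\<alpha>})"
  proof
    fix x assume x: "x \<in> {..long_ray_ord \<alpha>}"
    obtain \<beta> t where bt: "Rep_long_ray x = (\<beta>, t)" by fastforce
    then have t: "t \<in> {0..<1}" using Rep_long_ray[of x] by simp
    have "x = Abs_long_ray (\<beta>, t)" using bt by (metis Rep_long_ray_inverse)
    moreover have "\<beta> \<le> \<alpha>"
      using x bt by (auto simp: less_eq_long_ray_def long_ray_ord_def Rep_long_ray_Abs)
    ultimately show "x \<in> \<Union> (?S ` {..\<alpha>})" using t by blast
  qed
  have "closedin (top_of_set (\<Union> (?S ` {..\<alpha>}))) {..long_ray_ord \<alpha>}"
    using sub by (intro closed_subset) auto
  then have "Lindelof_space (subtopology (top_of_set (\<Union> (?S ` {..\<alpha>}))) {..long_ray_ord \<alpha>})"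
    using union by (rule Lindelof_space_closedin_subtopology[rotated])
  then show ?thesis
    using sub by (simp add: subtopology_subtopology Int_absorb1)
qed

lemma type_I_cover_long_ray: "type_I_cover euclidean (\<lambda>\<alpha>. {..<long_ray_ord \<alpha>})"
proof -
  have closure: "euclidean closure_of {..<long_ray_ord \<alpha>} \<subseteq> {..long_ray_ord \<alpha>}" for \<alpha>
    by (rule closure_of_minimal) auto
  have 1: "\<exists>\<alpha>. x < long_ray_ord \<alpha>" for x
    using countable_bounded_omega1[of "{fst (Rep_long_ray x)}"] by (simp add: less_long_ray_ord_iff)
  have 2: "Lindelof_space (top_of_set (euclidean closure_of {..<long_ray_ord \<alpha>}))" for \<alpha>
  proof -
    have "closedin (top_of_set {..long_ray_ord \<alpha>}) (euclidean closure_of {..<long_ray_ord \<alpha>})"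
      using closure[of \<alpha>] by (intro closed_subset) auto
    then have "Lindelof_space (subtopology (top_of_set {..long_ray_ord \<alpha>})
        (euclidean closure_of {..<long_ray_ord \<alpha>}))"
      by (rule Lindelof_space_closedin_subtopology[OF Lindelof_long_ray_Iic])
    then show ?thesis
      using closure[of \<alpha>] by (simp add: subtopology_subtopology Int_absorb1)
  qed
  have "long_ray_ord \<alpha> < long_ray_ord \<beta>" if "\<alpha> < \<beta>" for \<alpha> \<beta>
    using that unfolding less_long_ray_ord_iff by (simp add: long_ray_ord_def Rep_long_ray_Abs)
  then have 3: "euclidean closure_of {..<long_ray_ord \<alpha>} \<subseteq> {..<long_ray_ord \<beta>}" if "\<alpha> < \<beta>" for \<alpha> \<beta>
    using closure[of \<alpha>] that by (meson atMost_iff le_less_trans lessThan_iff subset_eq)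
  show ?thesis
    unfolding type_I_cover_def using 1 2 3 by auto
qed

lemma type_I_space_long_ray: "type_I_space (euclidean :: long_ray topology)"
proof -
  have "\<not> Lindelof_space (euclidean :: long_ray topology)"
  proof
    assume "Lindelof_space (euclidean :: long_ray topology)"
    then obtain \<alpha> where "(UNIV :: long_ray set) \<subseteq> {..<long_ray_ord \<alpha>}"
      using Lindelof_subset_type_I_cover[OF type_I_cover_long_ray, of UNIV] by auto
    then show False by blast
  qed
  moreover have "Hausdorff_space (euclidean :: long_ray topology)"
    unfolding Hausdorff_space_def disjnt_def
  proof (intro allI impI)
    fix x y :: long_ray
    assume "x \<in> topspace euclidean \<and> y \<in> topspace euclidean \<and> x \<noteq> y"
    then obtain U V where "open U" "open V" "x \<in> U" "y \<in> V" "U \<inter> V = {}"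
      using hausdorff[of x y] by blast
    then show "\<exists>U V. openin euclidean U \<and> openin euclidean V \<and> x \<in> U \<and> y \<in> V \<and> U \<inter> V = {}"
      unfolding open_openin[symmetric] by blast
  qed
  ultimately show ?thesis
    using type_I_cover_long_ray unfolding type_I_space_def by blast
qed

corollary bounded_in_long_ray_iff:
  "bounded_in euclidean S \<longleftrightarrow> (\<exists>\<alpha>. S \<subseteq> {..<long_ray_ord \<alpha>})"
  by (rule bounded_in_iff[OF type_I_cover_long_ray])


text \<open>A quantifier over spaces has to fix the type of points. An \<open>\<omega>\<close>-bounded, locally
  metrizable Type I space is the union of \<open>\<omega>\<^sub>1\<close> many compact metrizable sets, so it has at
  most continuum many points. Hence \<open>real topology\<close>, ranging over all topologies on
  all subsets of the type \<open>real\<close> (unrelated to the usual topology of the line), represents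
  every such space up to homeomorphism.\<close>

end

theory Submission
  imports Defs
begin

text \<open>
  Glue \<open>\<omega>\<^sub>1\<close> many copies of a metrizable continuum \<open>E\<close> with two marked points \<open>p\<close> and \<open>q\<close> end to
  end, letting the copies shrink to a single point at every limit ordinal. The result lies in
  \<open>E\<^bsup>\<omega>\<^sub>1\<^esup>\<close> as the set of all transfinite sequences \<open>q, q, \<dots>, s, p, p, \<dots>\<close>, whose closure adds only
  the constant sequence \<open>q\<close>; compactness of this closure yields \<open>\<omega>\<close>-boundedness and, since two
  clubs running to the same end always meet, normality. Several continua with a common starting point \<open>p\<close>
  may be used at once, one for each end of the space.

  For \<open>X\<close> take \<open>[0, 1]\<close> and \<open>[0, -1]\<close>, which gives the long line, and \<open>D = X\<close>. Collapsing the
  negative half maps \<open>X\<close> onto the long ray, and this map is constant on the club of nonpositive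
  points, so \<open>D\<close> is not a direction for the long ray. For \<open>T\<close> take the closed topologist's sine
  curve with \<open>p\<close> on its limit bar and \<open>q\<close> at the other end. No path leaves the limit bar, so by
  transfinite induction along \<open>X\<close> every continuous map from \<open>X\<close> to \<open>T\<close> is bounded, and \<open>D\<close> is a
  \<open>T\<close>-direction vacuously.
\<close>

section \<open>Long chains of continua\<close>

text \<open>The coordinate \<beta> records the progress through copy number \<beta>: finished
  (\<open>q\<close>), at \<open>s\<close>, or not yet begun (\<open>p\<close>). Gluing is automatic:
  the end \<open>q\<close> of copy \<alpha> and the start \<open>p\<close> of the next copy are the
  same function. Convergence becomes pointwise convergence.\<close>

definition chain_point :: "'a \<Rightarrow> 'a \<Rightarrow> omega1 \<Rightarrow> 'a \<Rightarrow> omega1 \<Rightarrow> 'a" where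
  "chain_point p q \<alpha> s = (\<lambda>\<beta>. if \<beta> < \<alpha> then q else if \<beta> = \<alpha> then s else p)"

lemma chain_point_simps [simp]:
  "\<beta> < \<alpha> \<Longrightarrow> chain_point p q \<alpha> s \<beta> = q"
  "chain_point p q \<alpha> s \<alpha> = s"
  "\<alpha> < \<beta> \<Longrightarrow> chain_point p q \<alpha> s \<beta> = p"
  by (auto simp: chain_point_def)

lemma ex_greater_omega1: "\<exists>\<beta>. (\<alpha> :: omega1) < \<beta>"
  using countable_bounded_omega1[of "{\<alpha>}"] by simp

text \<open>Each \<open>E q\<close> is one arm from \<open>p\<close> to \<open>q\<close>. Finiteness
  of \<open>Q\<close> makes \<open>initial\<close> open and \<open>compactification\<close> closed.
  By \<open>E_Int\<close>, a coordinate other than \<open>p\<close> determines its arm.\<close>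

locale long_chain =
  fixes p :: "'a::metric_space" and Q :: "'a set" and E :: "'a \<Rightarrow> 'a set"
  assumes finite_Q: "finite Q" and Q_nonempty: "Q \<noteq> {}"
    and compact_E: "q \<in> Q \<Longrightarrow> compact (E q)"
    and connected_E: "q \<in> Q \<Longrightarrow> connected (E q)"
    and end_in_E: "q \<in> Q \<Longrightarrow> q \<in> E q"
    and start_in_E: "q \<in> Q \<Longrightarrow> p \<in> E q"
    and end_neq_start: "q \<in> Q \<Longrightarrow> q \<noteq> p"
    and E_Int: "q \<in> Q \<Longrightarrow> q' \<in> Q \<Longrightarrow> q \<noteq> q' \<Longrightarrow> E q \<inter> E q' \<subseteq> {p}"
begin

definition points :: "(omega1 \<Rightarrow> 'a) set" where
  "points = {chain_point p q \<alpha> s | q \<alpha> s. q \<in> Q \<and> s \<in> E q}"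

abbreviation chain :: "(omega1 \<Rightarrow> 'a) topology" where
  "chain \<equiv> top_of_set points"

text \<open>By \<open>points_subset\<close> and \<open>compactification_cases\<close>, this is
  \<open>points\<close> together with the constant sequences at the ends. It is described by
  conditions on at most two coordinates at a time, from which closedness in the product can be read
  off.\<close>

definition compactification :: "(omega1 \<Rightarrow> 'a) set" where
  "compactification = {x. (\<forall>\<alpha>. x \<alpha> \<in> (\<Union>q\<in>Q. E q)) \<and>
     (\<forall>\<beta> \<gamma>. \<beta> < \<gamma> \<longrightarrow> x \<gamma> = p \<or> x \<beta> \<in> Q \<and> x \<gamma> \<in> E (x \<beta>))}"

text \<open>The points that have not completed copy number \<alpha>; the condition on one coordinate
  is open because \<open>Q\<close> is finite.\<close>

definition initial :: "omega1 \<Rightarrow> (omega1 \<Rightarrow> 'a) set" where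
  "initial \<alpha> = {x \<in> points. x \<alpha> \<notin> Q}"

text \<open>A closed counterpart of \<open>initial\<close>, cut out of
  \<open>compactification\<close> rather than \<open>points\<close> so that it is compact at
  once.\<close>

definition closed_initial :: "omega1 \<Rightarrow> (omega1 \<Rightarrow> 'a) set" where
  "closed_initial \<alpha> = {x \<in> compactification. \<forall>\<beta>>\<alpha>. x \<beta> = p}"

section \<open>Structure of the compactification\<close>

lemma p_notin_Q: "p \<notin> Q"
  using end_neq_start by blast

lemma same_end: "q \<in> Q \<Longrightarrow> q' \<in> Q \<Longrightarrow> s \<in> E q \<Longrightarrow> s \<in> E q' \<Longrightarrow> s \<noteq> p \<Longrightarrow> q = q'"
  using E_Int by blast

text \<open>A coordinate off \<open>p\<close> forces every earlier one to be an end whose arm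
  contains it, and since arms meet only in \<open>p\<close>, there is just one such end.\<close>

lemma compactification_below:
  assumes x: "x \<in> compactification" and "x \<gamma> \<noteq> p"
  shows "\<exists>q\<in>Q. (\<forall>\<beta><\<gamma>. x \<beta> = q) \<and> x \<gamma> \<in> E q"
proof -
  obtain q where q: "q \<in> Q" "x \<gamma> \<in> E q"
    using x unfolding compactification_def by blast
  have "x \<beta> = q" if "\<beta> < \<gamma>" for \<beta>
  proof (rule same_end[symmetric])
    show "x \<beta> \<in> Q" "x \<gamma> \<in> E (x \<beta>)"
      using x that \<open>x \<gamma> \<noteq> p\<close> by (auto simp: compactification_def)
  qed (use q assms in auto)
  then show ?thesis using q by blast
qed

lemma compactification_below_end:
  assumes "x \<in> compactification" "q \<in> Q" "x \<gamma> = q" "\<beta> < \<gamma>"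
  shows "x \<beta> = q"
proof -
  have "x \<gamma> \<noteq> p" using assms end_neq_start by auto
  then obtain q' where "q' \<in> Q" "\<forall>\<beta><\<gamma>. x \<beta> = q'" "x \<gamma> \<in> E q'"
    using compactification_below[OF assms(1)] by blast
  moreover from this have "q' = q"
    using same_end[of q' q "x \<gamma>"] assms end_in_E \<open>x \<gamma> \<noteq> p\<close> by auto
  ultimately show ?thesis using assms(4) by blast
qed

lemma points_subset: "points \<subseteq> compactification"
proof
  fix x assume "x \<in> points"
  then obtain q \<alpha> s where x: "x = chain_point p q \<alpha> s" "q \<in> Q" "s \<in> E q"
    by (auto simp: points_def)
  have "x \<beta> \<in> E q" for \<beta>
    using x end_in_E start_in_E by (auto simp: chain_point_def)
  moreover have "x \<gamma> = p \<or> x \<beta> = q" if "\<beta> < \<gamma>" for \<beta> \<gamma>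
    using that by (auto simp: x(1) chain_point_def)
  ultimately show "x \<in> compactification"
    using x(2) unfolding compactification_def by blast
qed

lemma chain_point_in_points: "q \<in> Q \<Longrightarrow> s \<in> E q \<Longrightarrow> chain_point p q \<alpha> s \<in> points"
  by (auto simp: points_def)

text \<open>The first index \<delta> whose coordinate is not an end is the active copy: after it
  everything is \<open>p\<close>, and before it all coordinates are ends, which agree with each
  other by \<open>compactification_below_end\<close>.\<close>

lemma compactification_eq_chain_point:
  assumes x: "x \<in> compactification" and "x \<alpha> \<notin> Q"
  shows "\<exists>q \<delta>. q \<in> Q \<and> x \<delta> \<in> E q \<and> x \<delta> \<notin> Q \<and> x = chain_point p q \<delta> (x \<delta>)"
proof -
  define \<delta> where "\<delta> = (LEAST \<delta>. x \<delta> \<notin> Q)"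
  have \<delta>: "x \<delta> \<notin> Q"
    unfolding \<delta>_def by (rule LeastI, rule assms(2))
  have below: "x \<beta> \<in> Q" if "\<beta> < \<delta>" for \<beta>
    using not_less_Least that unfolding \<delta>_def by blast
  have above: "x \<gamma> = p" if "\<delta> < \<gamma>" for \<gamma>
    using x \<delta> that unfolding compactification_def by blast
  have "\<exists>q\<in>Q. x \<delta> \<in> E q \<and> (\<forall>\<beta><\<delta>. x \<beta> = q)"
  proof (cases "x \<delta> = p")
    case False
    then show ?thesis using compactification_below[OF x] by blast
  next
    case True
    have eq: "x \<beta> = x \<gamma>" if "\<beta> < \<delta>" "\<gamma> < \<delta>" for \<beta> \<gamma>
      using that compactification_below_end[OF x, of "x \<beta>" \<beta> \<gamma>]
        compactification_below_end[OF x, of "x \<gamma>" \<gamma> \<beta>] below by (metis linorder_neqE)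
    show ?thesis
    proof (cases "\<exists>\<beta>. \<beta> < \<delta>")
      case True
      then obtain \<beta> where "\<beta> < \<delta>" by blast
      then show ?thesis using eq below start_in_E \<open>x \<delta> = p\<close> by metis
    next
      case False
      \<comment> \<open>Here \<delta> is the ordinal 0 and the sequence is constantly
        \<open>p\<close>, so any end will do.\<close>
      then show ?thesis using Q_nonempty start_in_E \<open>x \<delta> = p\<close> by fastforce
    qed
  qed
  then obtain q where "q \<in> Q" "x \<delta> \<in> E q" "\<forall>\<beta><\<delta>. x \<beta> = q" by blast
  moreover have "x = chain_point p q \<delta> (x \<delta>)"
    using calculation above by (auto simp: chain_point_def fun_eq_iff)
  ultimately show ?thesis using \<delta> by blast
qed

lemma compactification_cases:
  assumes x: "x \<in> compactification"
  obtains "x \<in> points" | q where "q \<in> Q" "x = (\<lambda>_. q)"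
proof (cases "\<exists>\<alpha>. x \<alpha> \<notin> Q")
  case True
  then obtain \<alpha> where "x \<alpha> \<notin> Q" by blast
  then show ?thesis
    using compactification_eq_chain_point[OF x] that(1) points_def by blast
next
  case False
  have "x \<beta> = x \<gamma>" for \<beta> \<gamma>
    using compactification_below_end[OF x, of "x \<beta>" \<beta> \<gamma>]
      compactification_below_end[OF x, of "x \<gamma>" \<gamma> \<beta>] False by (metis linorder_neqE)
  then have "x = (\<lambda>_. x undefined)" by blast
  then show ?thesis using that(2) False by blast
qed

lemma points_eventually_start:
  assumes "x \<in> points"
  shows "\<exists>\<alpha>. \<forall>\<beta>>\<alpha>. x \<beta> = p"
proof -
  obtain q \<alpha> s where "x = chain_point p q \<alpha> s"
    using assms by (auto simp: points_def)
  then show ?thesis by (intro exI[of _ \<alpha>]) simp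
qed

lemma start_in_points: "(\<lambda>_. p) \<in> points"
proof -
  obtain q where "q \<in> Q" using Q_nonempty by blast
  \<comment> \<open>\<open>LEAST _. True\<close> is the ordinal 0, so no coordinate comes before the
    active one.\<close>
  moreover have "chain_point p q (LEAST _. True) p = (\<lambda>_. p)"
    using not_less_Least[of _ "\<lambda>_::omega1. True"] by (auto simp: chain_point_def fun_eq_iff)
  ultimately show ?thesis using chain_point_in_points start_in_E by metis
qed

lemma closed_initial_subset_points: "closed_initial \<alpha> \<subseteq> points"
proof
  fix x assume x: "x \<in> closed_initial \<alpha>"
  obtain \<beta> where "\<alpha> < \<beta>" using ex_greater_omega1 by blast
  then have "x \<beta> = p" using x by (simp add: closed_initial_def)
  moreover have "x \<in> compactification" using x by (simp add: closed_initial_def)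
  ultimately show "x \<in> points"
    using compactification_cases[of x] end_neq_start by (metis (full_types))
qed

lemma initial_subset_closed_initial: "initial \<alpha> \<subseteq> closed_initial \<alpha>"
  using points_subset by (auto simp: initial_def closed_initial_def compactification_def)

lemma closed_initial_subset_initial: "\<alpha> < \<beta> \<Longrightarrow> closed_initial \<alpha> \<subseteq> initial \<beta>"
  using closed_initial_subset_points p_notin_Q by (auto simp: initial_def closed_initial_def)

section \<open>Closedness and compactness in the product\<close>

lemma closed_coordinate: "closed A \<Longrightarrow> closed {x :: omega1 \<Rightarrow> 'a. x \<alpha> \<in> A}"
  using closed_vimage[of A "\<lambda>x. x \<alpha>"] by (simp add: vimage_def)

lemma open_coordinate: "open A \<Longrightarrow> open {x :: omega1 \<Rightarrow> 'a. x \<alpha> \<in> A}"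
  using open_vimage[of A "\<lambda>x. x \<alpha>"] by (simp add: vimage_def)

text \<open>Splitting over the finitely many possible values of \<open>x \<beta>\<close> in
  \<open>Q\<close> turns the condition on two coordinates into a finite union of closed
  sets.\<close>

lemma closed_compactification: "closed compactification"
proof -
  have "compactification = (\<Inter>\<alpha>. {x. x \<alpha> \<in> (\<Union>q\<in>Q. E q)}) \<inter>
      (\<Inter>\<beta>. \<Inter>\<gamma>\<in>{\<beta><..}. {x. x \<gamma> \<in> {p}} \<union> (\<Union>q\<in>Q. {x. x \<beta> \<in> {q}} \<inter> {x. x \<gamma> \<in> E q}))"
    by (auto simp: compactification_def)
  also have "closed \<dots>"
    using finite_Q compact_E
    by (intro closed_Int closed_INT ballI closed_Un closed_UN closed_coordinate)
      (auto intro: compact_imp_closed)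
  finally show ?thesis .
qed

lemma Hausdorff_fun: "Hausdorff_space (euclidean :: (omega1 \<Rightarrow> 'a) topology)"
  unfolding euclidean_product_topology[symmetric] Hausdorff_space_product_topology by simp

lemma compact_compactification: "compact compactification"
proof -
  let ?S = "\<Union>q\<in>Q. E q"
  have "compact ?S" using finite_Q compact_E by (intro compact_UN) auto
  then have "compactin (product_topology (\<lambda>_::omega1. euclidean) UNIV) (PiE UNIV (\<lambda>_. ?S))"
    by (simp add: compactin_PiE)
  then have "compact (PiE (UNIV :: omega1 set) (\<lambda>_. ?S))"
    by (simp add: euclidean_product_topology)
  moreover have "compactification = PiE UNIV (\<lambda>_. ?S) \<inter> compactification"
    by (auto simp: compactification_def)
  ultimately show ?thesis
    using closed_compactification by (metis compact_Int_closed)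
qed

lemma closed_closed_initial: "closed (closed_initial \<alpha>)"
proof -
  have "closed_initial \<alpha> = compactification \<inter> (\<Inter>\<beta>\<in>{\<alpha><..}. {x. x \<beta> \<in> {p}})"
    by (auto simp: closed_initial_def)
  moreover have "closed (\<Inter>\<beta>\<in>{\<alpha><..}. {x :: omega1 \<Rightarrow> 'a. x \<beta> \<in> {p}})"
    by (intro closed_INT ballI closed_coordinate) auto
  ultimately show ?thesis
    using closed_compactification by (metis closed_Int)
qed

lemma compact_closed_initial: "compact (closed_initial \<alpha>)"
proof -
  have "closed_initial \<alpha> = compactification \<inter> closed_initial \<alpha>" by (auto simp: closed_initial_def)
  then show ?thesis
    using compact_compactification closed_closed_initial by (metis compact_Int_closed)
qed

lemma closure_initial: "chain closure_of initial \<alpha> \<subseteq> closed_initial \<alpha>"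
  using closed_initial_subset_points closed_closed_initial
  by (intro closure_of_minimal initial_subset_closed_initial closed_subset)

section \<open>Type I structure, \<open>\<omega>\<close>-boundedness and local metrizability\<close>

lemma compactin_chain: "K \<subseteq> points \<Longrightarrow> compact K \<Longrightarrow> compactin chain K"
  by (simp add: compactin_subtopology)

lemma openin_initial: "openin chain (initial \<alpha>)"
proof -
  have "initial \<alpha> = points \<inter> {x. x \<alpha> \<in> - Q}" by (auto simp: initial_def)
  moreover have "open {x :: omega1 \<Rightarrow> 'a. x \<alpha> \<in> - Q}"
    using finite_Q by (intro open_coordinate open_Compl finite_imp_closed)
  ultimately show ?thesis by (metis openin_open_Int)
qed

lemma type_I_cover_chain: "type_I_cover chain initial"
  unfolding type_I_cover_def
proof (intro conjI allI impI)
  show "topspace chain = (\<Union>\<alpha>. initial \<alpha>)"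
  proof -
    have "\<exists>\<alpha>. x \<in> initial \<alpha>" if "x \<in> points" for x
      using points_eventually_start[OF that] that ex_greater_omega1 p_notin_Q
      by (metis (mono_tags, lifting) initial_def mem_Collect_eq)
    then show ?thesis by (auto simp: initial_def)
  qed
  show "Lindelof_space (subtopology chain (chain closure_of initial \<alpha>))" for \<alpha>
  proof -
    have "closedin chain (chain closure_of initial \<alpha>)" by simp
    then have "compactin chain (chain closure_of initial \<alpha>)"
      by (rule closed_compactin[OF compactin_chain[OF closed_initial_subset_points compact_closed_initial]
            closure_initial])
    then show ?thesis
      by (intro compact_imp_Lindelof_space compact_space_subtopology)
  qed
  show "chain closure_of initial \<alpha> \<subseteq> initial \<beta>" if "\<alpha> < \<beta>" for \<alpha> \<beta>
    by (rule order_trans[OF closure_initial closed_initial_subset_initial[OF that]])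
qed (rule openin_initial)

lemma bounded_in_chain_iff: "bounded_in chain S \<longleftrightarrow> (\<exists>\<alpha>. S \<subseteq> initial \<alpha>)"
  by (rule bounded_in_iff[OF type_I_cover_chain])

lemma Hausdorff_chain: "Hausdorff_space chain"
  by (intro Hausdorff_space_subtopology Hausdorff_fun)

lemma unbounded_points: "\<not> points \<subseteq> initial \<alpha>"
proof -
  obtain q where "q \<in> Q" using Q_nonempty by blast
  then have "chain_point p q \<alpha> q \<in> points" "chain_point p q \<alpha> q \<notin> initial \<alpha>"
    by (auto simp: initial_def chain_point_in_points end_in_E)
  then show ?thesis by blast
qed

lemma type_I_chain: "type_I_space chain"
proof -
  have "\<not> Lindelof_space chain"
    using Lindelof_subset_type_I_cover[OF type_I_cover_chain, of points] unbounded_points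
    by (auto simp: subtopology_subtopology)
  then show ?thesis
    using Hausdorff_chain type_I_cover_chain by (auto simp: type_I_space_def)
qed

text \<open>Countably many indices have a common bound \<beta>, so a countable set lies in one
  \<open>initial \<beta>\<close> and its closure in the compact set
  \<open>closed_initial \<beta>\<close>.\<close>

lemma omega_bounded_chain: "omega_bounded_space chain"
  unfolding omega_bounded_space_def
proof (intro allI impI, elim conjE)
  fix A assume A: "A \<subseteq> topspace chain" "countable A"
  then have "\<forall>x\<in>A. \<exists>\<alpha>. x \<in> initial \<alpha>"
    using type_I_cover_chain by (auto simp: type_I_cover_def)
  then obtain r where r: "\<forall>x\<in>A. x \<in> initial (r x)" by metis
  obtain \<beta> where \<beta>: "\<forall>\<alpha>\<in>r ` A. \<alpha> < \<beta>"
    using countable_bounded_omega1[of "r ` A"] A(2) by blast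
  have "A \<subseteq> initial \<beta>"
  proof
    fix x assume "x \<in> A"
    moreover from this have "initial (r x) \<subseteq> initial \<beta>"
      using \<beta> by (intro type_I_cover_mono[OF type_I_cover_chain]) (simp add: less_imp_le)
    ultimately show "x \<in> initial \<beta>" using r by blast
  qed
  then have "chain closure_of A \<subseteq> closed_initial \<beta>"
    by (rule order_trans[OF closure_of_mono closure_initial])
  then show "compactin chain (chain closure_of A)"
    by (rule closed_compactin[OF compactin_chain[OF closed_initial_subset_points compact_closed_initial]]) simp
qed

text \<open>Only the countably many coordinates up to \<alpha> can differ from \<open>p\<close>.
  Restriction to them is injective and continuous on a compact space, hence embeds it into a
  countable product of metric spaces.\<close>

lemma metrizable_closed_initial: "metrizable_space (top_of_set (closed_initial \<alpha>))"
proof -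
  let ?P = "product_topology (\<lambda>_. euclidean :: 'a topology) {..\<alpha>}"
  let ?f = "\<lambda>x. restrict x {..\<alpha>}"
  have "{..\<alpha>} = insert \<alpha> {..<\<alpha>}" by auto
  then have "countable {..\<alpha>}" using countable_lessThan_omega1 by (metis countable_insert)
  then have "metrizable_space ?P"
    unfolding metrizable_space_product_topology
    by (auto intro: metrizable_space_euclidean countable_subset[of _ "{..\<alpha>}"])
  moreover have "embedding_map (top_of_set (closed_initial \<alpha>)) ?P ?f"
  proof (rule continuous_imp_embedding_map)
    show "continuous_map (top_of_set (closed_initial \<alpha>)) ?P ?f"
      unfolding continuous_map_componentwise
      by (auto intro: continuous_on_subset[OF continuous_on_product_coordinates])
    show "compact_space (top_of_set (closed_initial \<alpha>))"
      using compact_closed_initial by (simp add: compact_space_subtopology)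
    show "Hausdorff_space ?P" by (simp add: Hausdorff_space_product_topology)
    show "inj_on ?f (topspace (top_of_set (closed_initial \<alpha>)))"
    proof (rule inj_onI)
      fix x y assume xy: "x \<in> topspace (top_of_set (closed_initial \<alpha>))" "y \<in> topspace (top_of_set (closed_initial \<alpha>))"
        and eq: "?f x = ?f y"
      show "x = y"
      proof
        fix \<beta> show "x \<beta> = y \<beta>"
        proof (cases "\<beta> \<le> \<alpha>")
          case True
          then show ?thesis using fun_cong[OF eq, of \<beta>] by simp
        next
          case False
          then show ?thesis using xy by (simp add: closed_initial_def)
        qed
      qed
    qed
  qed
  ultimately show ?thesis
    by (meson embedding_map_imp_homeomorphic_space homeomorphic_metrizable_space
        metrizable_space_subtopology)
qed

lemma locally_metrizable_chain: "locally_metrizable_space chain"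
  unfolding locally_metrizable_space_def
proof
  fix x assume "x \<in> topspace chain"
  then obtain \<alpha> where "x \<in> initial \<alpha>"
    using type_I_cover_chain by (auto simp: type_I_cover_def)
  moreover have "metrizable_space (subtopology chain (initial \<alpha>))"
    using metrizable_space_subtopology[OF metrizable_closed_initial, of \<alpha> "initial \<alpha>"]
      initial_subset_closed_initial[of \<alpha>]  closed_initial_subset_points[of \<alpha>]
    by (simp add: subtopology_subtopology Int_absorb1)
  ultimately show "\<exists>U. openin chain U \<and> x \<in> U \<and> metrizable_space (subtopology chain U)"
    using openin_initial by blast
qed

section \<open>Limits along an end and normality\<close>

text \<open>Coordinates below the supremum \<mu> of the indices \<open>a n\<close> eventually equal
  \<open>q\<close>, and those from \<mu> on are always \<open>p\<close>. The limit therefore depends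
  only on \<open>q\<close> and \<mu>, not on the chosen points.\<close>

lemma tendsto_chain_point:
  assumes q: "q \<in> Q"
    and mono: "\<And>n. a n < a (Suc n)"
    and x: "\<And>n. x n \<in> points" "\<And>n. x n (a n) = q" "\<And>n \<beta>. a (Suc n) \<le> \<beta> \<Longrightarrow> x n \<beta> = p"
    and upper: "\<And>n. a n < \<mu>" and least: "\<And>\<gamma>. \<gamma> < \<mu> \<Longrightarrow> \<exists>n. \<gamma> \<le> a n"
  shows "x \<longlonglongrightarrow> chain_point p q \<mu> p"
proof -
  have sm: "strict_mono a" using mono by (simp add: strict_mono_Suc_iff)
  have "(\<lambda>n. x n \<gamma>) \<longlonglongrightarrow> chain_point p q \<mu> p \<gamma>" for \<gamma>
  proof (cases "\<gamma> < \<mu>")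
    case True
    then obtain n where n: "\<gamma> \<le> a n" using least by blast
    have "x m \<gamma> = q" if "m > n" for m
    proof (rule compactification_below_end[of _ q "a m"])
      show "\<gamma> < a m" using n sm that by (meson le_less_trans strict_monoD)
    qed (use x q points_subset in auto)
    then have "\<forall>\<^sub>F m in sequentially. x m \<gamma> = q"
      using eventually_gt_at_top[of n] by (rule eventually_mono[rotated])
    then show ?thesis using True by (simp add: tendsto_eventually)
  next
    case False
    then have "a (Suc n) \<le> \<gamma>" for n using upper[of "Suc n"] by simp
    then have "x n \<gamma> = p" for n using x(3) by blast
    then show ?thesis using False by (simp add: chain_point_def)
  qed
  then have "limitin (product_topology (\<lambda>_. euclidean) UNIV) x (chain_point p q \<mu> p) sequentially"
    by (simp add: limitin_componentwise)
  then show ?thesis by (simp add: euclidean_product_topology)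
qed

text \<open>Points of \<open>A\<close> and of \<open>B\<close> are chosen along the same increasing
  sequence of indices, so that both sequences converge to the same point at the supremum.\<close>

lemma closed_sets_meet_at_end:
  assumes q: "q \<in> Q" and A: "closedin chain A" and B: "closedin chain B"
    and unbounded: "\<And>\<alpha>. \<exists>x\<in>A. x \<alpha> = q" "\<And>\<alpha>. \<exists>x\<in>B. x \<alpha> = q"
  shows "A \<inter> B \<noteq> {}"
proof -
  have sub: "A \<subseteq> points" "B \<subseteq> points" using A B by (simp_all add: closedin_imp_subset)
  have "\<exists>\<beta>>\<alpha>. \<exists>x\<in>A. \<exists>y\<in>B. x \<alpha> = q \<and> y \<alpha> = q \<and> (\<forall>\<gamma>\<ge>\<beta>. x \<gamma> = p \<and> y \<gamma> = p)" for \<alpha>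
  proof -
    obtain x y where xy: "x \<in> A" "x \<alpha> = q" "y \<in> B" "y \<alpha> = q"
      using unbounded by meson
    obtain \<beta> \<beta>' where "\<forall>\<gamma>>\<beta>. x \<gamma> = p" "\<forall>\<gamma>>\<beta>'. y \<gamma> = p"
      using xy sub points_eventually_start by (meson subsetD)
    moreover obtain \<delta> where "\<forall>\<epsilon>\<in>{\<alpha>, \<beta>, \<beta>'}. \<epsilon> < \<delta>"
      using countable_bounded_omega1[of "{\<alpha>, \<beta>, \<beta>'}"] by auto
    ultimately show ?thesis
      using xy by (intro exI[of _ \<delta>] conjI bexI[of _ x] bexI[of _ y]) auto
  qed
  then obtain \<sigma> X Y where \<sigma>: "\<And>\<alpha>. \<alpha> < \<sigma> \<alpha>"
    and X: "\<And>\<alpha>. X \<alpha> \<in> A" "\<And>\<alpha>. X \<alpha> \<alpha> = q" "\<And>\<alpha> \<gamma>. \<sigma> \<alpha> \<le> \<gamma> \<Longrightarrow> X \<alpha> \<gamma> = p"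
    and Y: "\<And>\<alpha>. Y \<alpha> \<in> B" "\<And>\<alpha>. Y \<alpha> \<alpha> = q" "\<And>\<alpha> \<gamma>. \<sigma> \<alpha> \<le> \<gamma> \<Longrightarrow> Y \<alpha> \<gamma> = p"
    by metis
  \<comment> \<open>The starting index is arbitrary; only the iteration of \<sigma> matters.\<close>
  define a where "a n = (\<sigma> ^^ n) undefined" for n
  have a_Suc: "a (Suc n) = \<sigma> (a n)" for n by (simp add: a_def)
  \<comment> \<open>As the indices \<open>a n\<close> strictly increase, \<mu> is their
    supremum.\<close>
  define \<mu> where "\<mu> = (LEAST \<beta>. \<forall>n. a n < \<beta>)"
  have "\<exists>\<beta>. \<forall>n. a n < \<beta>"
    using countable_bounded_omega1[of "range a"] by auto
  then have upper: "\<forall>n. a n < \<mu>"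
    unfolding \<mu>_def by (rule LeastI_ex)
  have least: "\<exists>n. \<gamma> \<le> a n" if "\<gamma> < \<mu>" for \<gamma>
    using not_less_Least[OF that[unfolded \<mu>_def]] by (auto simp: not_less)
  let ?e = "chain_point p q \<mu> p"
  have e: "?e \<in> points" using q by (simp add: chain_point_in_points start_in_E)
  have "?e \<in> C" if C: "closedin chain C" "\<And>n. Z (a n) \<in> C" "\<And>\<alpha>. Z \<alpha> \<alpha> = q"
    "\<And>\<alpha> \<gamma>. \<sigma> \<alpha> \<le> \<gamma> \<Longrightarrow> Z \<alpha> \<gamma> = p" for C Z
  proof -
    have "(\<lambda>n. Z (a n)) \<longlonglongrightarrow> ?e"
      using C closedin_imp_subset[OF C(1)] \<sigma> upper least
      by (intro tendsto_chain_point[OF q, of a]) (auto simp: a_Suc)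
    moreover obtain C' where "closed C'" "C = points \<inter> C'"
      using C(1) unfolding closedin_closed by blast
    ultimately show ?thesis
      using C(2) e Lim_in_closed_set[of C' "\<lambda>n. Z (a n)" sequentially ?e] by simp
  qed
  from this[OF A, of X] this[OF B, of Y] show ?thesis
    using X Y by blast
qed

lemma unbounded_if_closure:
  assumes q: "q \<in> Q" and A: "A \<subseteq> points" and "(\<lambda>_. q) \<in> closure A"
  shows "\<exists>x\<in>A. x \<alpha> = q"
proof -
  obtain \<beta> where \<beta>: "\<alpha> < \<beta>" using ex_greater_omega1 by blast
  \<comment> \<open>Coordinate \<beta> off \<open>p\<close> forces the earlier coordinate \<alpha>
    to be an end, and the second condition excludes every end but \<open>q\<close>.\<close>
  define W where "W = {x :: omega1 \<Rightarrow> 'a. x \<beta> \<in> - {p}} \<inter> {x. x \<alpha> \<in> - (Q - {q})}"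
  have "open W"
    unfolding W_def using finite_Q by (intro open_Int open_coordinate open_Compl finite_imp_closed) auto
  moreover have "(\<lambda>_. q) \<in> W" using q end_neq_start by (auto simp: W_def)
  ultimately obtain x where x: "x \<in> A" "x \<in> W"
    using assms(3) by (metis closure_iff_nhds_not_empty disjoint_iff subset_refl)
  moreover from x have "x \<alpha> \<in> Q"
    using compactification_below[of x \<beta>] A points_subset \<beta> unfolding W_def by fastforce
  ultimately show ?thesis unfolding W_def by blast
qed

text \<open>The closures of \<open>A\<close> and \<open>B\<close> in \<open>compactification\<close>
  stay disjoint: a common point in \<open>points\<close> would lie in both sets, and a common end
  would make them meet by \<open>closed_sets_meet_at_end\<close>. They are separated in the compact
  Hausdorff \<open>compactification\<close>, and the separation is restricted.\<close>

lemma normal_chain: "normal_space chain"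
  unfolding normal_space_def
proof (intro allI impI, elim conjE)
  fix A B assume A: "closedin chain A" and B: "closedin chain B" and "disjnt A B"
  let ?K = "top_of_set compactification"
  have sub: "A \<subseteq> points" "B \<subseteq> points" using A B by (simp_all add: closedin_imp_subset)
  have clos: "closure A \<subseteq> compactification" "closure B \<subseteq> compactification"
    using sub points_subset closed_compactification by (meson closure_minimal order_trans)+
  have trace: "closure C \<inter> points = C" if C: "closedin chain C" for C
  proof -
    obtain C' where C': "closed C'" "C = points \<inter> C'"
      using C unfolding closedin_closed by blast
    then have "closure C \<subseteq> C'" by (intro closure_minimal) auto
    then show ?thesis using closure_subset[of C] C'(2) by auto
  qed
  have disj: "disjnt (closure A) (closure B)"
    unfolding disjnt_def
  proof (rule ccontr)
    assume "closure A \<inter> closure B \<noteq> {}"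
    then obtain z where z: "z \<in> closure A" "z \<in> closure B" by blast
    then have "z \<in> compactification" using clos by blast
    then show False
    proof (cases rule: compactification_cases)
      case 1
      then show False using z trace[OF A] trace[OF B] \<open>disjnt A B\<close> by (auto simp: disjnt_iff)
    next
      case (2 q)
      then have "A \<inter> B \<noteq> {}"
        using z sub by (intro closed_sets_meet_at_end[OF _ A B, of q] unbounded_if_closure) auto
      then show False using \<open>disjnt A B\<close> by (simp add: disjnt_def)
    qed
  qed
  have "normal_space ?K"
    using compact_compactification Hausdorff_space_subtopology[OF Hausdorff_fun]
    by (intro compact_Hausdorff_or_regular_imp_normal_space compact_space_subtopology) auto
  moreover have "closedin ?K (closure A)" "closedin ?K (closure B)"
    using clos by (auto intro: closed_subset)
  ultimately have "\<exists>U V. openin ?K U \<and> openin ?K V \<and> closure A \<subseteq> U \<and> closure B \<subseteq> V \<and> disjnt U V"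
    using disj by (simp add: normal_space_def)
  then obtain U V where UV: "openin ?K U" "openin ?K V" "closure A \<subseteq> U" "closure B \<subseteq> V" "disjnt U V"
    by blast
  have "openin chain (U \<inter> points)" "openin chain (V \<inter> points)"
    using UV(1,2) openin_subtopology_Int[of ?K _ points]
    by (simp_all add: subtopology_subtopology Int_absorb1[OF points_subset])
  moreover have "A \<subseteq> U \<inter> points" "B \<subseteq> V \<inter> points" "disjnt (U \<inter> points) (V \<inter> points)"
    using UV(3-5) sub closure_subset[of A] closure_subset[of B] by (auto simp: disjnt_iff)
  ultimately show "\<exists>U V. openin chain U \<and> openin chain V \<and> A \<subseteq> U \<and> B \<subseteq> V \<and> disjnt U V"
    by blast
qed

section \<open>Induction along a chain and connectedness\<close>

text \<open>A basic neighbourhood restricts finitely many coordinates. Lowering \<alpha> to some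
  \<gamma> beyond all restricted coordinates below \<alpha> changes only unrestricted ones.\<close>

lemma chain_point_limit:
  assumes "open W" "chain_point p q \<alpha> p \<in> W" "\<beta>\<^sub>0 < \<alpha>"
    and limit: "\<And>\<beta>. \<beta> < \<alpha> \<Longrightarrow> \<exists>\<gamma>. \<beta> < \<gamma> \<and> \<gamma> < \<alpha>"
  shows "\<exists>\<gamma><\<alpha>. chain_point p q \<gamma> p \<in> W"
proof -
  have "openin (product_topology (\<lambda>_. euclidean) UNIV) W"
    using \<open>open W\<close> by (simp add: euclidean_product_topology)
  from product_topology_open_contains_basis[OF this assms(2)]
  obtain B where B: "chain_point p q \<alpha> p \<in> PiE UNIV B" "finite {i. B i \<noteq> UNIV}" "PiE UNIV B \<subseteq> W"
    by auto
  \<comment> \<open>Inserting \<open>\<beta>\<^sub>0\<close> keeps \<open>F\<close> nonempty, so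
    that \<open>Max F\<close> makes sense.\<close>
  define F where "F = insert \<beta>\<^sub>0 ({i. B i \<noteq> UNIV} \<inter> {..<\<alpha>})"
  have F: "finite F" "F \<noteq> {}" using B(2) by (auto simp: F_def)
  have "Max F \<in> F" using F by simp
  then have "Max F < \<alpha>" using assms(3) by (auto simp: F_def)
  then obtain \<gamma> where \<gamma>: "Max F < \<gamma>" "\<gamma> < \<alpha>" using limit by blast
  have "chain_point p q \<gamma> p i \<in> B i" for i
  proof (cases "i < \<alpha> \<and> \<gamma> \<le> i")
    case True
    then have "i \<notin> F" using \<gamma>(1) F Max_ge[of F i] by auto
    then show ?thesis using True by (auto simp: F_def)
  next
    case False
    then have "chain_point p q \<gamma> p i = chain_point p q \<alpha> p i"
      using \<gamma> by (auto simp: chain_point_def)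
    then show ?thesis using B(1) by auto
  qed
  then show ?thesis using \<gamma> B(3) by blast
qed

text \<open>A set that is closed and is never left inside a single copy passes from copy to copy:
  closedness handles limits, and at successors the end of one copy is the start of the next.\<close>

lemma chain_induct:
  assumes V: "closedin chain V" and start: "(\<lambda>_. p) \<in> V"
    and step: "\<And>q \<alpha> s. q \<in> Q \<Longrightarrow> chain_point p q \<alpha> p \<in> V \<Longrightarrow> s \<in> E q \<Longrightarrow> chain_point p q \<alpha> s \<in> V"
  shows "V = points"
proof -
  obtain V' where V': "closed V'" "V = points \<inter> V'"
    using V unfolding closedin_closed by blast
  have *: "chain_point p q \<alpha> p \<in> V" if q: "q \<in> Q" for q \<alpha>
  proof (induction \<alpha> rule: less_induct)
    case (less \<alpha>)
    \<comment> \<open>The cases are zero, successor of \<beta>, and limit.\<close>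
    consider "\<forall>\<beta>. \<not> \<beta> < \<alpha>" | \<beta> where "\<beta> < \<alpha>" "\<forall>\<gamma>. \<beta> < \<gamma> \<longrightarrow> \<not> \<gamma> < \<alpha>"
      | \<beta> where "\<beta> < \<alpha>" "\<forall>\<beta><\<alpha>. \<exists>\<gamma>. \<beta> < \<gamma> \<and> \<gamma> < \<alpha>"
      by blast
    then show ?case
    proof cases
      case 1
      then have "chain_point p q \<alpha> p = (\<lambda>_. p)" by (auto simp: chain_point_def fun_eq_iff)
      then show ?thesis using start by simp
    next
      case (2 \<beta>)
      then have "chain_point p q \<alpha> p = chain_point p q \<beta> q"
        by (auto simp: chain_point_def fun_eq_iff)
      then show ?thesis using step[OF q less.IH[OF 2(1)]] end_in_E q by simp
    next
      case (3 \<beta>)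
      have "chain_point p q \<alpha> p \<in> V'"
      proof (rule ccontr)
        assume "chain_point p q \<alpha> p \<notin> V'"
        then obtain \<gamma> where "\<gamma> < \<alpha>" "chain_point p q \<gamma> p \<in> - V'"
          using chain_point_limit[of "- V'" q \<alpha> \<beta>] V'(1) 3 by auto
        then show False using less.IH V'(2) by blast
      qed
      then show ?thesis using V'(2) q by (simp add: chain_point_in_points start_in_E)
    qed
  qed
  have "points \<subseteq> V"
    using step[OF _ *] by (auto simp: points_def)
  then show ?thesis using V'(2) by blast
qed

lemma continuous_chain_point: "continuous_on A (chain_point p q \<alpha>)"
proof (rule continuous_on_coordinatewise_then_product)
  show "continuous_on A (\<lambda>s. chain_point p q \<alpha> s \<beta>)" for \<beta>
    by (cases \<beta> \<alpha> rule: linorder_cases) simp_all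
qed

text \<open>Each copy is connected, so a clopen set containing the start satisfies
  \<open>chain_induct\<close>. Of a clopen set and its complement, one contains the start.\<close>

lemma connected_chain: "connected_space chain"
  unfolding connected_space_clopen_in
proof (intro allI impI, elim conjE)
  have start: "T = points" if T: "openin chain T" "closedin chain T" "(\<lambda>_. p) \<in> T" for T
  proof (rule chain_induct[OF T(2,3)])
    fix q \<alpha> s assume q: "q \<in> Q" "chain_point p q \<alpha> p \<in> T" "s \<in> E q"
    have "connected (chain_point p q \<alpha> ` E q)"
      using connected_E q continuous_chain_point by (intro connected_continuous_image)
    then have "connectedin chain (chain_point p q \<alpha> ` E q)"
      using q chain_point_in_points by (auto simp: connectedin_subtopology)
    then have "chain_point p q \<alpha> ` E q \<subseteq> T \<or> disjnt (chain_point p q \<alpha> ` E q) T"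
      using connectedin_clopen_cases T by blast
    then show "chain_point p q \<alpha> s \<in> T"
      using q start_in_E by (auto simp: disjnt_iff)
  qed
  fix T assume T: "openin chain T" "closedin chain T"
  show "T = {} \<or> T = topspace chain"
  proof (cases "(\<lambda>_. p) \<in> T")
    case True
    then show ?thesis using start T by simp
  next
    case False
    then have "topspace chain - T = points"
      using T start_in_points by (intro start) (simp_all add: openin_diff closedin_diff)
    then show ?thesis using closedin_subset[OF T(2)] by auto
  qed
qed

end

section \<open>Homeomorphic copies\<close>

lemma homeomorphic_map_image_subtopology:
  assumes h: "homeomorphic_map X Y h" and S: "S \<subseteq> topspace X"
  shows "homeomorphic_map (subtopology X S) (subtopology Y (h ` S)) h"
proof (rule homeomorphic_map_subtopologies[OF h])
  have "h ` S \<subseteq> topspace Y"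
    using S homeomorphic_imp_surjective_map[OF h] by blast
  then show "h ` (topspace X \<inter> S) = topspace Y \<inter> h ` S"
    using S by (simp add: Int_absorb1)
qed

lemma Lindelof_homeomorphic_image:
  assumes "homeomorphic_map X Y h" "Lindelof_space X"
  shows "Lindelof_space Y"
  using assms Lindelof_space_continuous_map_image
  by (metis homeomorphic_imp_continuous_map homeomorphic_imp_surjective_map)

lemma type_I_cover_homeomorphic_image:
  assumes h: "homeomorphic_map X Y h" and U: "type_I_cover X U"
  shows "type_I_cover Y (\<lambda>\<alpha>. h ` U \<alpha>)"
proof -
  have sub: "U \<alpha> \<subseteq> topspace X" for \<alpha>
    using U by (auto simp: type_I_cover_def openin_subset)
  have cl: "Y closure_of (h ` U \<alpha>) = h ` (X closure_of U \<alpha>)" for \<alpha>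
    by (rule homeomorphic_map_closure_of[OF h sub])
  show ?thesis
    unfolding type_I_cover_def cl
  proof (intro conjI allI impI)
    show "topspace Y = (\<Union>\<alpha>. h ` U \<alpha>)"
      using U homeomorphic_imp_surjective_map[OF h] by (simp add: type_I_cover_def image_UN)
    show "openin Y (h ` U \<alpha>)" for \<alpha>
      using homeomorphic_map_openness[OF h sub] U by (simp add: type_I_cover_def)
    show "Lindelof_space (subtopology Y (h ` (X closure_of U \<alpha>)))" for \<alpha>
    proof (rule Lindelof_homeomorphic_image)
      show "homeomorphic_map (subtopology X (X closure_of U \<alpha>))
          (subtopology Y (h ` (X closure_of U \<alpha>))) h"
        by (rule homeomorphic_map_image_subtopology[OF h closure_of_subset_topspace])
      show "Lindelof_space (subtopology X (X closure_of U \<alpha>))"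
        using U by (simp add: type_I_cover_def)
    qed
    show "h ` (X closure_of U \<alpha>) \<subseteq> h ` U \<beta>" if "\<alpha> < \<beta>" for \<alpha> \<beta>
      using U that by (intro image_mono) (simp add: type_I_cover_def)
  qed
qed

lemma bounded_in_homeomorphic_image:
  assumes "homeomorphic_map X Y h" "bounded_in X S"
  shows "bounded_in Y (h ` S)"
proof -
  obtain U \<alpha> where "type_I_cover X U" "S \<subseteq> U \<alpha>"
    using assms(2) by (auto simp: bounded_in_def)
  then have "type_I_cover Y (\<lambda>\<alpha>. h ` U \<alpha>)" "h ` S \<subseteq> h ` U \<alpha>"
    using type_I_cover_homeomorphic_image[OF assms(1)] by auto
  then show ?thesis
    unfolding bounded_in_def by (intro exI[of _ "\<lambda>\<alpha>. h ` U \<alpha>"] exI[of _ \<alpha>] conjI)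
qed

lemma type_I_space_homeomorphic:
  assumes "homeomorphic_maps X Y h k" "type_I_space X"
  shows "type_I_space Y"
  unfolding type_I_space_def
proof (intro conjI notI)
  have hk: "homeomorphic_map X Y h" "homeomorphic_map Y X k"
    using assms(1) by (auto simp: homeomorphic_maps_map)
  show "Hausdorff_space Y"
    using assms(2) homeomorphic_Hausdorff_space[OF homeomorphic_map_imp_homeomorphic_space[OF hk(1)]]
    by (simp add: type_I_space_def)
  show False if "Lindelof_space Y"
    using Lindelof_homeomorphic_image[OF hk(2) that] assms(2) by (simp add: type_I_space_def)
  show "\<exists>U. type_I_cover Y U"
    using type_I_cover_homeomorphic_image[OF hk(1)] assms(2) unfolding type_I_space_def by blast
qed

lemma omega_bounded_space_homeomorphic:
  assumes hk: "homeomorphic_maps X Y h k" and X: "omega_bounded_space X"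
  shows "omega_bounded_space Y"
  unfolding omega_bounded_space_def
proof (intro allI impI, elim conjE)
  fix A assume A: "A \<subseteq> topspace Y" "countable A"
  have h: "homeomorphic_map X Y h"
    using hk by (auto simp: homeomorphic_maps_map)
  have kA: "k ` A \<subseteq> topspace X" "h ` k ` A = A"
    using hk A(1) by (auto simp: homeomorphic_maps_def continuous_map_def image_image subset_iff Pi_iff)
  then have "compactin X (X closure_of (k ` A))"
    using X A(2) by (simp add: omega_bounded_space_def)
  then have "compactin Y (h ` (X closure_of (k ` A)))"
    using homeomorphic_map_compactness[OF h closure_of_subset_topspace] by simp
  then show "compactin Y (Y closure_of A)"
    using homeomorphic_map_closure_of[OF h kA(1)] kA(2) by simp
qed

lemma locally_metrizable_space_homeomorphic:
  assumes hk: "homeomorphic_maps X Y h k" and X: "locally_metrizable_space X"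
  shows "locally_metrizable_space Y"
  unfolding locally_metrizable_space_def
proof
  have h: "homeomorphic_map X Y h"
    using hk by (auto simp: homeomorphic_maps_map)
  fix y assume "y \<in> topspace Y"
  then have y: "k y \<in> topspace X" "h (k y) = y"
    using hk by (auto simp: homeomorphic_maps_def continuous_map_def)
  then obtain U where U: "openin X U" "k y \<in> U" "metrizable_space (subtopology X U)"
    using X by (auto simp: locally_metrizable_space_def)
  have sub: "U \<subseteq> topspace X" by (rule openin_subset[OF U(1)])
  have "homeomorphic_map (subtopology X U) (subtopology Y (h ` U)) h"
    by (rule homeomorphic_map_image_subtopology[OF h sub])
  then have "metrizable_space (subtopology Y (h ` U))"
    using U(3) homeomorphic_metrizable_space homeomorphic_map_imp_homeomorphic_space by blast
  moreover have "openin Y (h ` U)"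
    using homeomorphic_map_openness[OF h sub] U(1) by simp
  moreover have "y \<in> h ` U"
    using y(2) U(2) by (metis imageI)
  ultimately show "\<exists>V. openin Y V \<and> y \<in> V \<and> metrizable_space (subtopology Y V)"
    by blast
qed

lemma club_in_homeomorphic_image:
  assumes hk: "homeomorphic_maps X Y h k" and C: "club_in X C"
  shows "club_in Y (h ` C)"
  unfolding club_in_def
proof
  have h: "homeomorphic_map X Y h" and k: "homeomorphic_map Y X k"
    using hk by (auto simp: homeomorphic_maps_map)
  have sub: "C \<subseteq> topspace X" using C by (simp add: club_in_def closedin_subset)
  show "closedin Y (h ` C)"
    using homeomorphic_map_closedness[OF h sub] C by (simp add: club_in_def)
  have "k ` h ` C = C"
    using hk sub by (force simp: homeomorphic_maps_def image_image subset_iff)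
  then show "\<not> bounded_in Y (h ` C)"
    using bounded_in_homeomorphic_image[OF k, of "h ` C"] C by (auto simp: club_in_def)
qed

text \<open>A map between the copies is conjugated to a map between the original spaces, and
  boundedness and clubs are carried along the homeomorphisms.\<close>

lemma direction_in_homeomorphic_image:
  assumes X: "homeomorphic_maps X X' h h'" and T: "homeomorphic_maps T T' k k'"
    and D: "D \<subseteq> topspace X" and dir: "direction_in X T D"
  shows "direction_in X' T' (h ` D)"
  unfolding direction_in_def
proof (intro allI impI, elim conjE, intro notI)
  fix f C
  assume f: "continuous_map X' T' f" and unb: "\<not> bounded_in T' (f ` h ` D)"
    and C: "C \<subseteq> h ` D" "club_in X' C" and bdd: "bounded_in T' (f ` C)"
  have k: "homeomorphic_map T T' k" "homeomorphic_map T' T k'"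
    using T by (auto simp: homeomorphic_maps_map)
  define g where "g = k' \<circ> f \<circ> h"
  have g: "continuous_map X T g"
    unfolding g_def using X T f by (metis continuous_map_compose homeomorphic_maps_def)
  have hD: "h x \<in> topspace X'" "f (h x) \<in> topspace T'" "h' (h x) = x" if "x \<in> D" for x
    using that D X f by (auto simp: homeomorphic_maps_def continuous_map_def)
  have "k ` g ` D = f ` h ` D"
    using hD T by (force simp: g_def homeomorphic_maps_def image_image)
  then have "\<not> bounded_in T (g ` D)"
    using unb bounded_in_homeomorphic_image[OF k(1), of "g ` D"] by auto
  moreover have "h' ` C \<subseteq> D"
    using C(1) hD(3) by auto
  moreover have "club_in X (h' ` C)"
    using club_in_homeomorphic_image[OF _ C(2)] X homeomorphic_maps_sym by blast
  ultimately have "\<not> bounded_in T (g ` h' ` C)"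
    using dir g unfolding direction_in_def by blast
  moreover have "g ` h' ` C = k' ` f ` C"
    using C(1) hD(3) by (force simp: g_def image_image subset_iff)
  ultimately show False
    using bounded_in_homeomorphic_image[OF k(2) bdd] by simp
qed

section \<open>Copies on sets of reals\<close>

text \<open>The topology is pulled back to the image of \<open>j\<close> along the inverse of
  \<open>j\<close>.\<close>

lemma homeomorphic_copy:
  fixes X :: "'b topology" and j :: "'b \<Rightarrow> 'c"
  assumes j: "inj_on j (topspace X)"
  obtains Y :: "'c topology" and h k where "homeomorphic_maps X Y h k"
proof
  let ?k = "inv_into (topspace X) j"
  let ?Y = "pullback_topology (j ` topspace X) ?k X"
  have "continuous_map X ?Y j"
  proof (rule continuous_map_pullback')
    show "continuous_map X X (?k \<circ> j)"
      using j by (intro continuous_map_eq[OF continuous_map_id]) simp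
  qed auto
  moreover have "continuous_map ?Y X ?k"
    using continuous_map_pullback[OF continuous_map_id, of "j ` topspace X" ?k X] by simp
  moreover have "j (?k y) = y" if "y \<in> topspace ?Y" for y
    using that by (auto simp: topspace_pullback_topology f_inv_into_f)
  ultimately show "homeomorphic_maps X ?Y j ?k"
    using j by (simp add: homeomorphic_maps_def)
qed

context includes cardinal_syntax
begin

text \<open>The continuum exceeds the countable cardinal, hence is at least its successor, which is
  the cardinality of \<open>omega1\<close>.\<close>

lemma ex_inj_omega1_real: "\<exists>f :: omega1 \<Rightarrow> real. inj f"
proof -
  let ?r = "cardSuc natLeq"
  have "|UNIV :: omega1 set| \<le>o |Field ?r|"
    using Rep_omega1 by (intro card_of_ordLeqI[of Rep_omega1]) (auto simp: inj_on_def Rep_omega1_inject)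
  moreover have "|Field ?r| =o ?r"
    by (rule card_of_Field_ordIso[OF cardSuc_Card_order[OF natLeq_Card_order]])
  moreover have "\<not> |UNIV :: real set| \<le>o natLeq"
    using uncountable_UNIV_real by (simp add: countable_card_le_natLeq)
  then have "natLeq <o |UNIV :: real set|"
    using not_ordLeq_iff_ordLess[OF natLeq_Well_order card_of_Well_order] by blast
  then have "?r \<le>o |UNIV :: real set|"
    using cardSuc_ordLess_ordLeq[OF natLeq_Card_order card_of_Card_order] by blast
  ultimately have "|UNIV :: omega1 set| \<le>o |UNIV :: real set|"
    using ordLeq_ordIso_trans ordLeq_transitive by blast
  then show ?thesis by (auto simp flip: card_of_ordLeq)
qed

lemma ex_inj_real_Times: "\<exists>f :: real \<times> real \<Rightarrow> real. inj f"
proof -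
  have "|(UNIV :: real set) \<times> (UNIV :: real set)| =o |UNIV :: real set|"
    by (rule card_of_Times_same_infinite) (rule infinite_UNIV_char_0)
  then have "|UNIV :: (real \<times> real) set| \<le>o |UNIV :: real set|"
    by (simp add: ordIso_imp_ordLeq)
  then show ?thesis by (auto simp flip: card_of_ordLeq)
qed

end

text \<open>A point is coded by a triple of end, index and position. Several triples may describe
  one point; \<open>inv\<close> selects one of them.\<close>

lemma (in long_chain) ex_inj_points_real:
  assumes "inj (i :: 'a \<Rightarrow> real)"
  shows "\<exists>j :: (omega1 \<Rightarrow> 'a) \<Rightarrow> real. inj_on j points"
proof -
  obtain w :: "omega1 \<Rightarrow> real" where w: "inj w" using ex_inj_omega1_real by blast
  obtain c :: "real \<times> real \<Rightarrow> real" where c: "inj c" using ex_inj_real_Times by blast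
  define g where "g = (\<lambda>(q, \<alpha>, s). c (i q, c (w \<alpha>, i s)))"
  have g: "inj g"
    unfolding g_def by (auto intro!: injI dest!: injD[OF assms] injD[OF w] injD[OF c])
  let ?\<phi> = "\<lambda>(q, \<alpha>, s). chain_point p q \<alpha> s"
  have "points \<subseteq> range ?\<phi>"
    by (auto simp: points_def intro!: rev_image_eqI[of "(_, _, _)"])
  then have "inj_on (inv ?\<phi>) points" by (rule inj_on_inv_into)
  then have "inj_on (g \<circ> inv ?\<phi>) points"
    using g by (metis comp_inj_on inj_on_subset subset_UNIV)
  then show ?thesis by blast
qed

lemma (in long_chain) real_copy_of_chain:
  assumes "inj (i :: 'a \<Rightarrow> real)"
  obtains X :: "real topology" and h k where "homeomorphic_maps chain X h k"
    "type_I_space X" "omega_bounded_space X" "normal_space X" "connected_space X"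
    "locally_metrizable_space X"
proof -
  obtain j :: "(omega1 \<Rightarrow> 'a) \<Rightarrow> real" where "inj_on j points"
    using ex_inj_points_real[OF assms] by blast
  then obtain X :: "real topology" and h k where hk: "homeomorphic_maps chain X h k"
    using homeomorphic_copy[of j chain] by auto
  then have "chain homeomorphic_space X"
    by (rule homeomorphic_maps_imp_homeomorphic_space)
  then show ?thesis
    using that[OF hk] hk type_I_space_homeomorphic type_I_chain
      omega_bounded_space_homeomorphic omega_bounded_chain
      locally_metrizable_space_homeomorphic locally_metrizable_chain
      homeomorphic_normal_space normal_chain homeomorphic_connected_space connected_chain
    by metis
qed

section \<open>The long line and the long sine curve\<close>

definition sine_curve :: "(real \<times> real) set" where
  "sine_curve = {(t, y). 0 \<le> t \<and> t \<le> 1 \<and> \<bar>y\<bar> \<le> 1 \<and> (t = 0 \<or> y = sin (1 / t))}"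

text \<open>Multiplying \<open>y = sin (1 / t)\<close> by \<open>t\<close> gives an equation between
  continuous functions that is vacuous at \<open>t = 0\<close>, which is exactly the limit
  bar.\<close>

lemma closed_sine_curve: "closed sine_curve"
proof -
  have lim: "((\<lambda>t. t * sin (1 / t)) \<longlongrightarrow> 0) (at (0::real))"
  proof (rule Lim_null_comparison)
    show "\<forall>\<^sub>F t in at 0. norm (t * sin (1 / t)) \<le> \<bar>t::real\<bar>"
      by (intro always_eventually allI) (simp add: abs_mult mult_left_le)
    show "((\<lambda>t. \<bar>t::real\<bar>) \<longlongrightarrow> 0) (at 0)"
      by (rule tendsto_rabs_zero) (rule tendsto_ident_at)
  qed
  have "isCont (\<lambda>t::real. t * sin (1 / t)) t" for t
  proof (cases "t = 0")
    case True
    then show ?thesis using lim by (simp add: isCont_def)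
  next
    case False
    then show ?thesis by (intro continuous_intros) auto
  qed
  then have "continuous_on UNIV (\<lambda>t::real. t * sin (1 / t))"
    by (simp add: continuous_at_imp_continuous_on)
  then have "continuous_on UNIV (\<lambda>z::real \<times> real. fst z * sin (1 / fst z))"
    by (rule continuous_on_compose2) (auto intro!: continuous_intros)
  from closed_Collect_eq[OF _ this, of "\<lambda>z. fst z * snd z"]
  have "closed {z :: real \<times> real. fst z * snd z = fst z * sin (1 / fst z)}"
    by (simp add: continuous_intros)
  moreover have "closed ({0..1::real} \<times> {-1..1::real})"
    by (intro closed_Times) auto
  ultimately have "closed ({z. fst z * snd z = fst z * sin (1 / fst z)} \<inter> {0..1} \<times> {-1..1::real})"
    by (rule closed_Int)
  also have "{z. fst z * snd z = fst z * sin (1 / fst z)} \<inter> {0..1} \<times> {-1..1} = sine_curve"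
    by (auto simp: sine_curve_def)
  finally show ?thesis .
qed

lemma compact_sine_curve: "compact sine_curve"
proof -
  have "sine_curve = ({0..1} \<times> {-1..1}) \<inter> sine_curve" by (auto simp: sine_curve_def)
  moreover have "compact ({0..1::real} \<times> {-1..1::real})" by (intro compact_Times) auto
  ultimately show ?thesis using closed_sine_curve compact_Int_closed by metis
qed

lemma sine_attained:
  fixes c d :: real
  assumes "0 < d" "\<bar>c\<bar> \<le> 1"
  shows "\<exists>t. 0 < t \<and> t < d \<and> sin (1 / t) = c"
proof -
  obtain n :: nat where n: "1 / d + pi < real n" using reals_Archimedean2 by blast
  define u where "u = arcsin c + real n * (2 * pi)"
  have "- (pi / 2) \<le> arcsin c" using assms by (intro arcsin_lbound) auto
  moreover have "real n * 1 \<le> real n * (2 * pi)" using pi_gt3 by (intro mult_left_mono) auto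
  ultimately have u: "1 / d < u" using n pi_gt_zero unfolding u_def by linarith
  then have "0 < u" using assms by (meson divide_pos_pos less_trans zero_less_one)
  moreover have "sin u = c"
  proof -
    have "sin (real n * (2 * pi)) = 0" "cos (real n * (2 * pi)) = 1"
      using sin_int_2pin[of "int n"] cos_int_2pin[of "int n"] by (simp_all add: mult_ac)
    then show ?thesis using assms by (simp add: u_def sin_add)
  qed
  ultimately show ?thesis
    using u assms by (intro exI[of _ "1 / u"]) (auto simp: field_simps)
qed

text \<open>The curve lies between the connected graph over \<open>{0<..1}\<close> and its closure,
  since every height on the bar is attained arbitrarily close to it.\<close>

lemma connected_sine_curve: "connected sine_curve"
proof -
  define G where "G = (\<lambda>t::real. (t, sin (1 / t))) ` {0<..1}"
  have "connected G"
    unfolding G_def by (intro connected_continuous_image continuous_intros) auto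
  moreover have "G \<subseteq> sine_curve" by (auto simp: G_def sine_curve_def)
  moreover have "sine_curve \<subseteq> closure G"
  proof (clarsimp simp: sine_curve_def)
    fix t y :: real assume ty: "0 \<le> t" "t \<le> 1" "\<bar>y\<bar> \<le> 1" "t = 0 \<or> y = sin (1 / t)"
    show "(t, y) \<in> closure G"
    proof (cases "t = 0")
      case False
      then have "(t, y) \<in> G" using ty by (auto simp: G_def)
      then show ?thesis using closure_subset by blast
    next
      case True
      show ?thesis
        unfolding closure_approachable
      proof (intro allI impI)
        fix e :: real assume "0 < e"
        then obtain s where s: "0 < s" "s < min e 1" "sin (1 / s) = y"
          using sine_attained[of "min e 1" y] ty(3) by auto
        then have "(s, y) \<in> G" by (auto simp: G_def intro!: image_eqI[of _ _ s])
        moreover have "dist (s, y) (t, y) < e" using s True by (simp add: dist_Pair_Pair dist_real_def)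
        ultimately show "\<exists>z\<in>G. dist z (t, y) < e" by blast
      qed
    qed
  qed
  ultimately show ?thesis by (rule connected_intermediate_closure)
qed

text \<open>The parameters at which the path is on the bar form a clopen subset of \<open>I\<close>.
  A path leaving the bar would, within any short time, sweep through all heights from -1 to 1,
  contrary to continuity.\<close>

lemma no_path_out_of_limit_bar:
  fixes u :: "real \<Rightarrow> real \<times> real"
  assumes I: "is_interval I" and u: "continuous_on I u" "u ` I \<subseteq> sine_curve"
    and a: "a \<in> I" "fst (u a) = 0" and b: "b \<in> I"
  shows "fst (u b) = 0"
proof -
  define P where "P = {s \<in> I. fst (u s) = 0}"
  have cont: "continuous_on I (\<lambda>s. fst (u s))" using u(1) by (rule continuous_on_fst)
  have "closedin (top_of_set I) P"
    using continuous_closedin_preimage_constant[OF cont, of 0] by (simp add: P_def)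
  moreover have "openin (top_of_set I) P"
    unfolding openin_euclidean_subtopology_iff
  proof (intro conjI ballI)
    show "P \<subseteq> I" by (auto simp: P_def)
    fix s assume s: "s \<in> P"
    then obtain d where d: "0 < d" "\<And>r. r \<in> I \<Longrightarrow> dist r s < d \<Longrightarrow> dist (u r) (u s) < 1 / 2"
      using u(1) unfolding continuous_on_iff P_def by (metis (mono_tags, lifting) half_gt_zero mem_Collect_eq zero_less_one)
    have "r \<in> P" if r: "r \<in> I" "dist r s < d" for r
    proof (rule ccontr)
      assume "r \<notin> P"
      define J where "J = I \<inter> ball s d"
      have J: "r \<in> J" "s \<in> J" "J \<subseteq> I"
        using r s d(1) by (auto simp: J_def P_def dist_commute)
      have "is_interval J" unfolding J_def by (intro is_interval_Int I is_interval_ball_real)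
      then have "connected ((\<lambda>s. fst (u s)) ` J)"
        using J cont by (intro connected_continuous_image)
          (auto intro: continuous_on_subset simp: is_interval_connected)
      then have conn: "is_interval ((\<lambda>s. fst (u s)) ` J)" by (simp add: is_interval_connected_1)
      have "0 < fst (u r)" using \<open>r \<notin> P\<close> r(1) u(2) by (force simp: P_def sine_curve_def)
      \<comment> \<open>On the interval \<open>J\<close> the first coordinate takes all values
        between 0 and \<open>fst (u r)\<close>, among them one where the curve has height
        \<open>c\<close>, while the path stays within 1/2 of \<open>u s\<close>.\<close>
      have "\<bar>c - snd (u s)\<bar> < 1 / 2" if c: "\<bar>c\<bar> \<le> 1" for c
      proof -
        obtain t where t: "0 < t" "t < fst (u r)" "sin (1 / t) = c"
          using sine_attained[OF \<open>0 < fst (u r)\<close> c] by blast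
        have "fst (u s) = 0" using s by (simp add: P_def)
        then have "t \<in> (\<lambda>s. fst (u s)) ` J"
          using conn J t unfolding is_interval_1 by (metis imageI less_imp_le)
        then obtain v where v: "v \<in> J" "fst (u v) = t" by blast
        then have "snd (u v) = c" using u(2) J(3) t by (force simp: sine_curve_def)
        moreover have "dist (u v) (u s) < 1 / 2" using d(2)[of v] v(1) by (simp add: J_def dist_commute)
        ultimately show ?thesis using dist_snd_le[of "u v" "u s"] by (simp add: dist_real_def)
      qed
      from this[of 1] this[of "-1"] show False by linarith
    qed
    then show "\<exists>e>0. \<forall>r\<in>I. dist r s < e \<longrightarrow> r \<in> P" using d(1) by blast
  qed
  moreover have "connected I" using I by (simp add: is_interval_connected)
  ultimately have "P = {} \<or> P = I" by (auto simp: connected_clopen)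
  then show ?thesis using a b by (auto simp: P_def)
qed

interpretation long_sine: long_chain "(0, 0)" "{(1, sin 1)}" "\<lambda>_. sine_curve"
  by unfold_locales (auto simp: compact_sine_curve connected_sine_curve, auto simp: sine_curve_def)

interpretation long_line: long_chain "0 :: real" "{1, - 1}" "closed_segment 0"
  by unfold_locales (auto simp: closed_segment_eq_real_ivl)

section \<open>Maps from the long line to the long sine curve\<close>

text \<open>A single coordinate \<beta> of the image is a map into the sine curve. If it starts on
  the limit bar, it stays there along every copy, hence everywhere by \<open>chain_induct\<close>,
  and never reaches the end \<open>(1, sin 1)\<close>.\<close>

lemma long_line_to_long_sine_bounded:
  assumes f: "continuous_map long_line.chain long_sine.chain f"
  shows "bounded_in long_sine.chain (f ` long_line.points)"
proof -
  have fp: "f x \<in> long_sine.points" if "x \<in> long_line.points" for x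
    using f that by (auto simp: continuous_map_def)
  \<comment> \<open>The image of the start is eventually \<open>(0, 0)\<close>, which yields a
    coordinate \<beta> that starts on the bar.\<close>
  obtain \<gamma> where \<gamma>: "\<forall>\<beta>>\<gamma>. f (\<lambda>_. 0) \<beta> = (0, 0)"
    using long_sine.points_eventually_start fp long_line.start_in_points by blast
  obtain \<beta> where "\<gamma> < \<beta>" using ex_greater_omega1 by blast
  then have start: "f (\<lambda>_. 0) \<beta> = (0, 0)" using \<gamma> by blast
  have cont: "continuous_on long_line.points (\<lambda>x. f x \<beta>)"
    using f by (auto intro: continuous_on_product_then_coordinatewise)
  have curve: "f x \<beta> \<in> sine_curve" if "x \<in> long_line.points" for x
    using long_sine.points_subset fp[OF that] by (auto simp: long_sine.compactification_def)
  define V where "V = {x \<in> long_line.points. fst (f x \<beta>) = 0}"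
  have "V = long_line.points"
  proof (rule long_line.chain_induct)
    show "closedin long_line.chain V"
      using continuous_closedin_preimage_constant[OF continuous_on_fst[OF cont], of 0]
      by (simp add: V_def)
    show "(\<lambda>_. 0) \<in> V" using start by (simp add: V_def long_line.start_in_points)
    fix q \<alpha> s assume q: "q \<in> {1, - 1}" "chain_point 0 q \<alpha> 0 \<in> V" "s \<in> closed_segment 0 (q :: real)"
    let ?c = "chain_point 0 q \<alpha>"
    have mem: "?c ` closed_segment 0 q \<subseteq> long_line.points"
      using q(1) long_line.chain_point_in_points by blast
    have "fst (f (?c s) \<beta>) = 0"
    proof (rule no_path_out_of_limit_bar[of "closed_segment 0 q" "\<lambda>s. f (?c s) \<beta>" 0])
      show "continuous_on (closed_segment 0 q) (\<lambda>s. f (?c s) \<beta>)"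
        by (rule continuous_on_compose2[OF cont long_line.continuous_chain_point mem])
      show "fst (f (?c 0) \<beta>) = 0" using q(2) by (simp add: V_def)
    qed (use q mem curve in \<open>auto simp: is_interval_closed_segment_1\<close>)
    then show "?c s \<in> V" using mem q(3) by (auto simp: V_def)
  qed
  then have "f ` long_line.points \<subseteq> long_sine.initial \<beta>"
    using fp by (fastforce simp: V_def long_sine.initial_def)
  then show ?thesis by (auto simp: long_sine.bounded_in_chain_iff)
qed

text \<open>No continuous map meets the unboundedness hypothesis of
  \<open>direction_in\<close>.\<close>

lemma direction_long_sine: "direction_in long_line.chain long_sine.chain long_line.points"
  using long_line_to_long_sine_bounded by (auto simp: direction_in_def)

lemma club_long_line: "club_in long_line.chain long_line.points"
  using long_line.unbounded_points
  by (auto simp: club_in_def long_line.bounded_in_chain_iff)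

section \<open>Folding the long line onto the long ray\<close>

text \<open>On the positive half, the least \<alpha> with \<open>x \<alpha> < 1\<close> is the
  active copy; the end 1 of a copy counts as the start of the next, as fits the half-open segments
  of the ray. On the negative half, \<alpha> is 0 and \<open>max\<close> gives the origin.\<close>

definition fold_to_ray :: "(omega1 \<Rightarrow> real) \<Rightarrow> long_ray" where
  "fold_to_ray x = (let \<alpha> = (LEAST \<alpha>. x \<alpha> < 1) in Abs_long_ray (\<alpha>, max 0 (x \<alpha>)))"

lemma long_line_bounds:
  assumes x: "x \<in> long_line.points"
  shows "- 1 \<le> x \<alpha>" "x \<alpha> \<le> 1"
proof -
  have "x \<alpha> \<in> closed_segment 0 1 \<union> closed_segment 0 (- 1)"
    using x long_line.points_subset by (auto simp: long_line.compactification_def)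
  then show "- 1 \<le> x \<alpha>" "x \<alpha> \<le> 1" by (auto simp: closed_segment_eq_real_ivl)
qed

lemma long_line_nonpos_above:
  assumes x: "x \<in> long_line.points" and "x \<beta> < 1" "\<beta> < \<gamma>"
  shows "x \<gamma> \<le> 0"
proof (rule ccontr)
  assume "\<not> x \<gamma> \<le> 0"
  then obtain q where "q \<in> {1, - 1}" "\<forall>\<beta><\<gamma>. x \<beta> = q" "x \<gamma> \<in> closed_segment 0 q"
    using long_line.compactification_below[of x \<gamma>] x long_line.points_subset by fastforce
  then show False
    using assms \<open>\<not> x \<gamma> \<le> 0\<close> by (auto simp: closed_segment_eq_real_ivl)
qed

lemma Rep_fold_to_ray:
  assumes x: "x \<in> long_line.points"
  obtains \<alpha> where "Rep_long_ray (fold_to_ray x) = (\<alpha>, max 0 (x \<alpha>))" "x \<alpha> < 1"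
    "\<And>\<beta>. \<beta> < \<alpha> \<Longrightarrow> x \<beta> = 1"
proof
  let ?\<alpha> = "LEAST \<alpha>. x \<alpha> < 1"
  obtain \<beta> where "\<forall>\<gamma>>\<beta>. x \<gamma> = 0" using long_line.points_eventually_start[OF x] by blast
  moreover obtain \<gamma> where "\<beta> < \<gamma>" using ex_greater_omega1 by blast
  ultimately have "x \<gamma> < 1" by simp
  then show *: "x ?\<alpha> < 1" by (rule LeastI)
  show "Rep_long_ray (fold_to_ray x) = (?\<alpha>, max 0 (x ?\<alpha>))"
    unfolding fold_to_ray_def Let_def using * by (intro Rep_long_ray_Abs) auto
  show "x \<beta> = 1" if "\<beta> < ?\<alpha>" for \<beta>
    using not_less_Least[OF that] long_line_bounds[OF x, of \<beta>] by simp
qed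

text \<open>Being below \<open>a\<close> is thus an open condition on coordinates. The guard
  \<open>0 < t\<close> is needed since a negative \<open>x \<delta>\<close> is folded to 0, which is
  not below \<open>t = 0\<close>.\<close>

lemma fold_to_ray_less_iff:
  assumes x: "x \<in> long_line.points" and a: "Rep_long_ray a = (\<delta>, t)"
  shows "fold_to_ray x < a \<longleftrightarrow> (\<exists>\<beta><\<delta>. x \<beta> < 1) \<or> 0 < t \<and> x \<delta> < t"
proof -
  obtain \<alpha> where \<alpha>: "Rep_long_ray (fold_to_ray x) = (\<alpha>, max 0 (x \<alpha>))" "x \<alpha> < 1"
    "\<And>\<beta>. \<beta> < \<alpha> \<Longrightarrow> x \<beta> = 1"
    using Rep_fold_to_ray[OF x] by blast
  have t: "0 \<le> t" "t < 1" using Rep_long_ray[of a] a by auto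
  show ?thesis
    using \<alpha> t a by (cases \<alpha> \<delta> rule: linorder_cases) (force simp: less_long_ray_def)+
qed

text \<open>As \<open>0 \<le> t\<close>, the condition \<open>t < x \<delta>\<close> makes
  \<open>x \<delta>\<close> positive, so by \<open>long_line_nonpos_above\<close> all earlier
  coordinates are 1 and the active copy is not before \<delta>.\<close>

lemma less_fold_to_ray_iff:
  assumes x: "x \<in> long_line.points" and a: "Rep_long_ray a = (\<delta>, t)"
  shows "a < fold_to_ray x \<longleftrightarrow> t < x \<delta>"
proof -
  obtain \<alpha> where \<alpha>: "Rep_long_ray (fold_to_ray x) = (\<alpha>, max 0 (x \<alpha>))" "x \<alpha> < 1"
    "\<And>\<beta>. \<beta> < \<alpha> \<Longrightarrow> x \<beta> = 1"
    using Rep_fold_to_ray[OF x] by blast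
  have t: "0 \<le> t" "t < 1" using Rep_long_ray[of a] a by auto
  show ?thesis
    using \<alpha> t a long_line_nonpos_above[OF x \<alpha>(2), of \<delta>]
    by (cases \<alpha> \<delta> rule: linorder_cases) (auto simp: less_long_ray_def)
qed

lemma continuous_fold_to_ray: "continuous_on long_line.points fold_to_ray"
proof (rule continuous_on_generate_topology[OF open_long_ray_def])
  have op: "open {x :: omega1 \<Rightarrow> real. x \<alpha> \<in> A}" if "open A" for \<alpha> A
    using open_vimage[OF that, of "\<lambda>x. x \<alpha>"] by (simp add: vimage_def)
  fix B :: "long_ray set" assume "B \<in> range (\<lambda>a. {..<a}) \<union> range (\<lambda>a. {a<..})"
  then consider a where "B = {..<a}" | a where "B = {a<..}" by auto
  then show "\<exists>C. open C \<and> C \<inter> long_line.points = fold_to_ray -` B \<inter> long_line.points"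
  proof cases
    case (1 a)
    obtain \<delta> t where a: "Rep_long_ray a = (\<delta>, t)" by fastforce
    let ?C = "(\<Union>\<beta>\<in>{..<\<delta>}. {x. x \<beta> \<in> {..<1}}) \<union> (if 0 < t then {x. x \<delta> \<in> {..<t}} else {})"
    have "open ?C"
      using op[of "{..<1}"] op[of "{..<t}" \<delta>] by (intro open_Un open_UN) simp_all
    moreover have "?C \<inter> long_line.points = fold_to_ray -` B \<inter> long_line.points"
      using fold_to_ray_less_iff[OF _ a] by (auto simp: 1)
    ultimately show ?thesis by blast
  next
    case (2 a)
    obtain \<delta> t where a: "Rep_long_ray a = (\<delta>, t)" by fastforce
    have "{x. x \<delta> \<in> {t<..}} \<inter> long_line.points = fold_to_ray -` B \<inter> long_line.points"
      using less_fold_to_ray_iff[OF _ a] by (auto simp: 2)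
    moreover have "open {x :: omega1 \<Rightarrow> real. x \<delta> \<in> {t<..}}" by (rule op) simp
    ultimately show ?thesis by (intro exI conjI)
  qed
qed

lemma fold_to_ray_less_ord_iff:
  "x \<in> long_line.points \<Longrightarrow> fold_to_ray x < long_ray_ord \<alpha> \<longleftrightarrow> (\<exists>\<beta><\<alpha>. x \<beta> < 1)"
  using fold_to_ray_less_iff[of x "long_ray_ord \<alpha>" \<alpha> 0]
  by (simp add: long_ray_ord_def Rep_long_ray_Abs)

text \<open>The folding map is unbounded on the whole line but constant on the club \<open>C\<close>
  of nonpositive points.\<close>

lemma not_direction_long_ray:
  "\<not> direction_in long_line.chain (euclidean :: long_ray topology) long_line.points"
proof
  assume dir: "direction_in long_line.chain (euclidean :: long_ray topology) long_line.points"
  have "\<not> bounded_in euclidean (fold_to_ray ` long_line.points)"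
    unfolding bounded_in_long_ray_iff
  proof
    assume "\<exists>\<alpha>. fold_to_ray ` long_line.points \<subseteq> {..<long_ray_ord \<alpha>}"
    then obtain \<alpha> where *: "fold_to_ray ` long_line.points \<subseteq> {..<long_ray_ord \<alpha>}" by blast
    \<comment> \<open>All coordinates before \<alpha> are 1, so the image is not below
      \<open>long_ray_ord \<alpha>\<close>.\<close>
    have "chain_point 0 1 \<alpha> 0 \<in> long_line.points"
      by (intro long_line.chain_point_in_points) auto
    then show False
      using * fold_to_ray_less_ord_iff[of "chain_point 0 1 \<alpha> 0" \<alpha>] by (auto simp: image_subset_iff)
  qed
  moreover define C where "C = {x \<in> long_line.points. \<forall>\<beta>. x \<beta> \<le> 0}"
  have "closedin long_line.chain C"
  proof -
    have "C = long_line.points \<inter> (\<Inter>\<beta>. {x. x \<beta> \<in> {..0}})" by (auto simp: C_def)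
    moreover have "closed (\<Inter>\<beta>. {x :: omega1 \<Rightarrow> real. x \<beta> \<in> {..0}})"
      by (intro closed_INT ballI long_line.closed_coordinate) auto
    ultimately show ?thesis by (metis closedin_closed_Int)
  qed
  moreover have "\<not> bounded_in long_line.chain C"
    unfolding long_line.bounded_in_chain_iff
  proof
    assume "\<exists>\<alpha>. C \<subseteq> long_line.initial \<alpha>"
    then obtain \<alpha> where *: "C \<subseteq> long_line.initial \<alpha>" by blast
    have "chain_point 0 (- 1) \<alpha> (- 1) \<in> C"
      unfolding C_def using long_line.chain_point_in_points[of "- 1" "- 1" \<alpha>]
      by (auto simp: chain_point_def)
    then show False using * by (auto simp: long_line.initial_def)
  qed
  ultimately have "\<not> bounded_in euclidean (fold_to_ray ` C)"
    using dir continuous_fold_to_ray unfolding direction_in_def club_in_def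
    by (simp add: C_def)
  \<comment> \<open>Every coordinate of a point of \<open>C\<close> is below 1, so an index above an
    arbitrary one already bounds the image.\<close>
  moreover obtain \<alpha> where "(undefined :: omega1) < \<alpha>" using ex_greater_omega1 by blast
  have "fold_to_ray x < long_ray_ord \<alpha>" if "x \<in> C" for x
  proof -
    have "x undefined < 1" using that by (auto simp: C_def intro: le_less_trans)
    then show ?thesis
      using that \<open>undefined < \<alpha>\<close> by (auto simp: C_def fold_to_ray_less_ord_iff)
  qed
  then have "bounded_in euclidean (fold_to_ray ` C)"
    unfolding bounded_in_long_ray_iff by blast
  ultimately show False by blast
qed

theorem theorem10p4:
  "\<exists>(X :: real topology) (T :: real topology) (D :: real set).
     type_I_space X \<and> omega_bounded_space X \<and> normal_space X \<and>
     connected_space X \<and> locally_metrizable_space X \<and>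
     type_I_space T \<and> omega_bounded_space T \<and> normal_space T \<and>
     connected_space T \<and> locally_metrizable_space T \<and>
     club_in X D \<and> direction_in X T D \<and>
     \<not> direction_in X (euclidean :: long_ray topology) D"
proof -
  obtain X :: "real topology" and h h' where X: "homeomorphic_maps long_line.chain X h h'"
    "type_I_space X" "omega_bounded_space X" "normal_space X" "connected_space X"
    "locally_metrizable_space X"
    using long_line.real_copy_of_chain[OF inj_on_id] by blast
  obtain i :: "real \<times> real \<Rightarrow> real" where "inj i" using ex_inj_real_Times by blast
  then obtain T :: "real topology" and k k' where T: "homeomorphic_maps long_sine.chain T k k'"
    "type_I_space T" "omega_bounded_space T" "normal_space T" "connected_space T"
    "locally_metrizable_space T"
    using long_sine.real_copy_of_chain by blast
  let ?D = "h ` long_line.points"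
  have club: "club_in X ?D"
    by (rule club_in_homeomorphic_image[OF X(1) club_long_line])
  have dir: "direction_in X T ?D"
    by (rule direction_in_homeomorphic_image[OF X(1) T(1) _ direction_long_sine]) simp
  \<comment> \<open>A direction in the copy would be carried back along the inverse homeomorphism,
    with the identity on the ray.\<close>
  have "\<not> direction_in X (euclidean :: long_ray topology) ?D"
  proof
    assume dir: "direction_in X (euclidean :: long_ray topology) ?D"
    have sub: "?D \<subseteq> topspace X"
      using club by (simp add: club_in_def closedin_subset)
    have inv: "homeomorphic_maps X long_line.chain h' h"
      using X(1) by (rule homeomorphic_maps_sym[THEN iffD1])
    have ray: "homeomorphic_maps (euclidean :: long_ray topology) euclidean id id"
      by (rule homeomorphic_maps_id[THEN iffD2]) (rule refl)
    have "direction_in long_line.chain (euclidean :: long_ray topology) (h' ` ?D)"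
      by (rule direction_in_homeomorphic_image[OF inv ray sub dir])
    moreover have "h' ` ?D = long_line.points"
      using X(1) by (force simp: homeomorphic_maps_def)
    ultimately show False using not_direction_long_ray by simp
  qed
  then show ?thesis using X T club dir by blast
qed

end
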